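(* Let $A=(a_{i,j})\in\mathbb{R}_+^{n\times n}$ and let $k$ be a critical node of $A$. Let $H$ be the component of the critical graph $\mathcal{C}(A)$ containing $k$, let $\lvert H\rvert$ be its number of nodes and $g(H)$ its girth. Then each of the following quantities is an upper bound on both the transient $T_k(A)$ of the $k$-th row and the transient of the $k$-th column of $A$: (i) (Wielandt bound) $\mathrm{Wi}(n)$; (ii) (Dulmage–Mendelsohn bound) $(n-2)\cdot g(H)+\lvert H\rvert$. If moreover $A$ is irreducible and $d$ denotes the cyclicity of $\mathcal{G}(A)$, then the following are also upper bounds on the transients of the $k$-th row and the $k$-th column: (iii) (Schwarz bound) $d\cdot \mathrm{Wi}\left(\left\lfloor n/d\right\rfloor\right)+(n\bmod d)$; (iv) (Kim bound) $\left(\left\lfloor n/d\right\rfloor-2\right)\cdot g(H)+\min\big(n,\ \lvert H\rvert+(n\bmod d)\big)$.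
   Context: Max algebra: $\mathbb{R}_+=[0,\infty)$ with $a\oplus b=\max(a,b)$ and usual multiplication. For $A\in\mathbb{R}_+^{n\times n}$, $(A\otimes B)_{i,j}=\max_l a_{i,l}b_{l,j}$, $A^{\otimes t}$ is the $t$-fold max-algebraic power ($A^{\otimes 0}$ the identity), with entries $a^{(t)}_{i,j}$. The weighted digraph $\mathcal{G}(A)$ has node set $N=\{1,\dots,n\}$ and an edge $(i,j)$ of weight $a_{i,j}$ whenever $a_{i,j}>0$. The weight of a walk is the product of its edge weights; a cycle is a closed walk with no repeated nodes other than start=end. $\lambda(A)$ is the maximum of $p(C)^{1/\ell(C)}$ over nonempty cycles $C$ of $\mathcal{G}(A)$ ($p$ = weight, $\ell$ = length), and $\lambda(A)=0$ if there is none. Cycles attaining $\lambda(A)$ are critical, as are their nodes and edges; the critical graph $\mathcal{C}(A)$ consists of all critical nodes and critical edges, and its components are its (strongly) connected components. $A$ is irreducible if $\mathcal{G}(A)$ is strongly connected. The cyclicity of a strongly connected digraph is the gcd of the lengths of its cycles; the girth $g(H)$ is the smallest length of a nonempty cycle in $H$. The transient $T_k(A)$ of the $k$-th row is the least $t\ge0$ such that for some $p>0$, $a^{(s+p)}_{k,i}=\lambda(A)^p a^{(s)}_{k,i}$ for all $i\in N$ and all $s\ge t$; the transient of the $k$-th column is defined analogously with $a_{i,k}$. Wielandt number: $\mathrm{Wi}(1)=0$ and $\mathrm{Wi}(m)=(m-1)^2+1$ for $m>1$. *)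

theory Defs
  imports "HOL-Analysis.Analysis" "Graph_Theory.Graph_Theory"
begin

text \<open>
  The node set \<open>{1..n}\<close> is a finite type \<open>'n\<close> with \<open>n = CARD('n)\<close>. The semiring
  \<open>([0,\<infinity>), max, *)\<close> has no type of its own: entries are of type \<^typ>\<open>real\<close>, and
  nonnegativity is an explicit hypothesis wherever it matters.
\<close>

definition max_mult :: "real^'n^'n \<Rightarrow> real^'n^'n \<Rightarrow> real^'n^'n" where
  "max_mult A B = (\<chi> i j. Max (range (\<lambda>l. A $ i $ l * B $ l $ j)))"

text \<open>The max-algebraic identity has the same entries as the usual one, \<open>mat 1\<close>.\<close>

primrec max_power :: "real^'n^'n \<Rightarrow> nat \<Rightarrow> real^'n^'n" where
  "max_power A 0 = mat 1"
| "max_power A (Suc t) = max_mult A (max_power A t)"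

definition mat_digraph :: "real^'n^'n \<Rightarrow> ('n, 'n \<times> 'n) pre_digraph" where
  "mat_digraph A =
     \<lparr>verts = UNIV, arcs = {(i, j). A $ i $ j > 0}, tail = fst, head = snd\<rparr>"

definition mat_irreducible :: "real^'n^'n \<Rightarrow> bool" where
  "mat_irreducible A \<longleftrightarrow> strongly_connected (mat_digraph A)"

text \<open>
  Walks and cycles are lists of arcs, as in \<^const>\<open>pre_digraph.cycle\<close>; the latter
  excludes the empty walk and admits loops as cycles of length 1.
\<close>

definition walk_weight :: "real^'n^'n \<Rightarrow> ('n \<times> 'n) list \<Rightarrow> real" where
  "walk_weight A p = (\<Prod>e\<leftarrow>p. A $ fst e $ snd e)"

definition cycle_mean :: "real^'n^'n \<Rightarrow> ('n \<times> 'n) list \<Rightarrow> real" where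
  "cycle_mean A p = walk_weight A p powr (1 / real (length p))"

definition max_cycle_mean :: "real^'n^'n \<Rightarrow> real" where
  "max_cycle_mean A =
     (if \<exists>p. pre_digraph.cycle (mat_digraph A) p
      then Max {cycle_mean A p | p. pre_digraph.cycle (mat_digraph A) p}
      else 0)"

definition critical_cycle :: "real^'n^'n \<Rightarrow> ('n \<times> 'n) list \<Rightarrow> bool" where
  "critical_cycle A p \<longleftrightarrow>
     pre_digraph.cycle (mat_digraph A) p \<and> cycle_mean A p = max_cycle_mean A"

definition critical_digraph :: "real^'n^'n \<Rightarrow> ('n, 'n \<times> 'n) pre_digraph" where
  "critical_digraph A =
     \<lparr>verts = {i. \<exists>p. critical_cycle A p \<and> (\<exists>e\<in>set p. i = fst e \<or> i = snd e)},
      arcs = {e. \<exists>p. critical_cycle A p \<and> e \<in> set p},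
      tail = fst, head = snd\<rparr>"

definition cyclicity :: "('a, 'b) pre_digraph \<Rightarrow> nat" where
  "cyclicity G = Gcd {length p | p. pre_digraph.cycle G p}"

text \<open>Meaningful only for digraphs that contain a cycle.\<close>

definition girth :: "('a, 'b) pre_digraph \<Rightarrow> nat" where
  "girth G = (LEAST l. \<exists>p. pre_digraph.cycle G p \<and> length p = l)"

definition row_periodic_from :: "real^'n^'n \<Rightarrow> 'n \<Rightarrow> nat \<Rightarrow> bool" where
  "row_periodic_from A k t \<longleftrightarrow>
     (\<exists>p>0. \<forall>s\<ge>t. \<forall>i.
        max_power A (s + p) $ k $ i = max_cycle_mean A ^ p * max_power A s $ k $ i)"

definition column_periodic_from :: "real^'n^'n \<Rightarrow> 'n \<Rightarrow> nat \<Rightarrow> bool" where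
  "column_periodic_from A k t \<longleftrightarrow>
     (\<exists>p>0. \<forall>s\<ge>t. \<forall>i.
        max_power A (s + p) $ i $ k = max_cycle_mean A ^ p * max_power A s $ i $ k)"

text \<open>
  The two transients below are meaningful only if some \<open>t\<close> with the respective
  property exists; this has to be asserted alongside any bound on them.
\<close>

definition row_transient :: "real^'n^'n \<Rightarrow> 'n \<Rightarrow> nat" where
  "row_transient A k = (LEAST t. row_periodic_from A k t)"

definition column_transient :: "real^'n^'n \<Rightarrow> 'n \<Rightarrow> nat" where
  "column_transient A k = (LEAST t. column_periodic_from A k t)"

text \<open>The Wielandt number is only used for positive arguments.\<close>

definition Wi :: "nat \<Rightarrow> nat" where
  "Wi m = (if m \<le> 1 then 0 else (m - 1)\<^sup>2 + 1)"

text \<open>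
  The bound is an integer because the expressions it stands for contain
  differences such as \<open>n - 2\<close> that can be negative.
\<close>

definition transients_le :: "real^'n^'n \<Rightarrow> 'n \<Rightarrow> int \<Rightarrow> bool" where
  "transients_le A k b \<longleftrightarrow>
     int (row_transient A k) \<le> b \<and> int (column_transient A k) \<le> b"

end

theory Submission
  imports Defs "HOL-Number_Theory.Cong"
begin

text \<open>
  Divide the entries by \<open>\<lambda>(A)\<close>, so that closed walks weigh at most 1 and closed critical walks weigh
  exactly 1. Let \<open>d\<close> be the cyclicity, or 1 for (i) and (ii), which then become instances of (iii)
  and (iv). Split the nodes into \<open>d\<close> cyclic classes, and let \<open>Z\<close> be a shortest cycle of \<open>H\<close>, of
  length \<open>g = h * d\<close>. Put \<open>q = \<lfloor>n / d\<rfloor>\<close> and \<open>r = n mod d\<close>.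

  If \<open>z\<close> lies on \<open>Z\<close> and its class has \<open>c\<close> nodes, a walk of length \<open>c * g\<close> from \<open>z\<close>
  visits some node twice at times divisible by \<open>g\<close>; replacing the closed part in between by turns
  of \<open>Z\<close> shows that row \<open>z\<close> is periodic from \<open>g * (c - 1)\<close> on. If \<open>Z\<close> exhausts the class
  (\<open>h = c\<close>), this improves to \<open>d * Wi c\<close>, by a zero-sum argument in \<open>\<int>/c\<close>. Going back along a
  critical arc delays periodicity by at most one step. So walk from \<open>k\<close> along a shortest
  critical path to \<open>Z\<close> and then along \<open>Z\<close>: either some class has fewer than \<open>q\<close> nodes, which
  leaves enough room, or at most \<open>r\<close> classes have more than \<open>q\<close> nodes, and counting the visits of
  the walk to each class bounds the time when it meets \<open>Z\<close> in a class of size \<open>q\<close> by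
  \<open>min n (|H| + r) - g\<close>. All this is invariant under transposition, which gives the bounds for
  columns.
\<close>

section \<open>Max-algebraic powers and walks\<close>

abbreviation pw :: "real^'n^'n \<Rightarrow> nat \<Rightarrow> 'n \<Rightarrow> 'n \<Rightarrow> real" where
  "pw A t i j \<equiv> max_power A t $ i $ j"

definition nonneg_matrix :: "real^'n^'n \<Rightarrow> bool" where
  "nonneg_matrix A \<longleftrightarrow> (\<forall>i j. 0 \<le> A $ i $ j)"

lemma pw_0: "pw A 0 i j = (if i = j then 1 else 0)"
  by (simp add: mat_def)

lemma pw_Suc: "pw A (Suc t) i j = Max (range (\<lambda>l. A $ i $ l * pw A t l j))"
  by (simp add: max_mult_def)

lemma pw_Suc_ge: "A $ i $ l * pw A t l j \<le> pw A (Suc t) i j"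
  unfolding pw_Suc by (rule Max_ge) auto

lemma pw_Suc_obtain:
  obtains l where "pw A (Suc t) i j = A $ i $ l * pw A t l j"
proof -
  have "pw A (Suc t) i j \<in> range (\<lambda>l. A $ i $ l * pw A t l j)"
    unfolding pw_Suc by (rule Max_in) auto
  then show ?thesis using that by auto
qed

declare max_power.simps [simp del]

lemma pw_1:
  assumes "nonneg_matrix A"
  shows "pw A (Suc 0) i j = A $ i $ j"
proof (rule antisym)
  obtain l where "pw A (Suc 0) i j = A $ i $ l * pw A 0 l j" by (rule pw_Suc_obtain)
  then show "pw A (Suc 0) i j \<le> A $ i $ j"
    using assms by (auto simp: pw_0 nonneg_matrix_def)
  show "A $ i $ j \<le> pw A (Suc 0) i j"
    using pw_Suc_ge[of A i j 0 j] by (simp add: pw_0)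
qed

lemma pw_nonneg:
  assumes "nonneg_matrix A"
  shows "0 \<le> pw A t i j"
proof (induction t arbitrary: i)
  case (Suc t)
  have "0 \<le> A $ i $ i * pw A t i j" using Suc assms by (simp add: nonneg_matrix_def)
  then show ?case using pw_Suc_ge[of A i i t j] by linarith
qed (simp add: pw_0)

lemma pw_add_ge:
  assumes "nonneg_matrix A"
  shows "pw A s i l * pw A t l j \<le> pw A (s + t) i j"
proof (induction s arbitrary: i)
  case 0
  then show ?case using pw_nonneg[OF assms] by (simp add: pw_0)
next
  case (Suc s)
  obtain m where m: "pw A (Suc s) i l = A $ i $ m * pw A s m l" by (rule pw_Suc_obtain)
  have "pw A (Suc s) i l * pw A t l j = A $ i $ m * (pw A s m l * pw A t l j)" by (simp add: m)
  also have "\<dots> \<le> A $ i $ m * pw A (s + t) m j"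
    using Suc assms by (intro mult_left_mono) (auto simp: nonneg_matrix_def)
  also have "\<dots> \<le> pw A (Suc s + t) i j" using pw_Suc_ge[of A i m "s + t" j] by simp
  finally show ?case .
qed

lemma pw_add_ge':
  assumes "nonneg_matrix A" "s + t = r"
  shows "pw A s i l * pw A t l j \<le> pw A r i j"
  using pw_add_ge[OF assms(1)] assms(2) by blast

lemma pw_add_obtain:
  assumes "nonneg_matrix A"
  obtains l where "pw A (s + t) i j = pw A s i l * pw A t l j"
proof -
  have "\<exists>l. pw A (s + t) i j = pw A s i l * pw A t l j"
  proof (induction s arbitrary: i)
    case 0
    show ?case by (rule exI[of _ i]) (simp add: pw_0)
  next
    case (Suc s)
    obtain m where m: "pw A (Suc (s + t)) i j = A $ i $ m * pw A (s + t) m j" by (rule pw_Suc_obtain)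
    obtain l where l: "pw A (s + t) m j = pw A s m l * pw A t l j" using Suc by blast
    have "pw A (Suc s + t) i j = A $ i $ m * pw A s m l * pw A t l j" using m l by simp
    also have "\<dots> \<le> pw A (Suc s) i l * pw A t l j"
      by (intro mult_right_mono pw_Suc_ge pw_nonneg[OF assms])
    finally have "pw A (Suc s + t) i j = pw A (Suc s) i l * pw A t l j"
      using pw_add_ge[OF assms, of "Suc s" i l t j] by (rule antisym)
    then show ?case ..
  qed
  then show ?thesis using that by blast
qed

text \<open>Each step of \<open>x\<close> stands for a best walk of \<open>g\<close> arcs, so
  \<open>x\<close> records only the nodes visited at multiples of \<open>g\<close>;
  \<open>g = 1\<close> gives ordinary walks.\<close>

definition seq_weight :: "real^'n^'n \<Rightarrow> nat \<Rightarrow> (nat \<Rightarrow> 'n) \<Rightarrow> nat \<Rightarrow> nat \<Rightarrow> real" where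
  "seq_weight A g x s t = (\<Prod>u\<in>{s..<t}. pw A g (x u) (x (Suc u)))"

lemma seq_weight_nonneg: "nonneg_matrix A \<Longrightarrow> 0 \<le> seq_weight A g x s t"
  unfolding seq_weight_def by (intro prod_nonneg) (auto simp: pw_nonneg)

lemma seq_weight_split:
  "s \<le> u \<Longrightarrow> u \<le> t \<Longrightarrow> seq_weight A g x s t = seq_weight A g x s u * seq_weight A g x u t"
  unfolding seq_weight_def by (simp add: prod.atLeastLessThan_concat)

lemma seq_weight_le_pw:
  assumes "nonneg_matrix A" "s \<le> t"
  shows "seq_weight A g x s t \<le> pw A ((t - s) * g) (x s) (x t)"
proof -
  have "seq_weight A g x s (s + m) \<le> pw A (m * g) (x s) (x (s + m))" for m
  proof (induction m)
    case (Suc m)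
    have "seq_weight A g x s (s + Suc m) = seq_weight A g x s (s + m) * pw A g (x (s + m)) (x (s + Suc m))"
      by (simp add: seq_weight_def)
    also have "\<dots> \<le> pw A (m * g) (x s) (x (s + m)) * pw A g (x (s + m)) (x (s + Suc m))"
      by (intro mult_right_mono Suc pw_nonneg assms)
    also have "\<dots> \<le> pw A (Suc m * g) (x s) (x (s + Suc m))"
      by (intro pw_add_ge') (auto simp: assms)
    finally show ?case .
  qed (simp add: seq_weight_def pw_0)
  from this[of "t - s"] assms show ?thesis by simp
qed

lemma pw_seq_obtain:
  assumes "nonneg_matrix A" "0 < pw A (m * g) i j"
  obtains x where "x 0 = i" "x m = j" "pw A (m * g) i j = seq_weight A g x 0 m"
proof -
  have "\<exists>x. x 0 = i \<and> x m = j \<and> pw A (m * g) i j = seq_weight A g x 0 m"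
    using assms(2)
  proof (induction m arbitrary: j)
    case 0
    then have "i = j" by (auto simp: pw_0 split: if_splits)
    then show ?case by (auto simp: seq_weight_def pw_0)
  next
    case (Suc m)
    obtain l where l: "pw A (m * g + g) i j = pw A (m * g) i l * pw A g l j"
      by (rule pw_add_obtain[OF assms(1)])
    have "0 < pw A (m * g) i l * pw A g l j" using Suc.prems l by (simp add: add.commute)
    then have "0 < pw A (m * g) i l" using pw_nonneg[OF assms(1)]
      by (metis less_eq_real_def mult_eq_0_iff)
    then obtain x where x: "x 0 = i" "x m = l" "pw A (m * g) i l = seq_weight A g x 0 m"
      using Suc.IH by blast
    have "seq_weight A g (x(Suc m := j)) 0 m = seq_weight A g x 0 m"
      unfolding seq_weight_def by (intro prod.cong) auto
    then have "seq_weight A g (x(Suc m := j)) 0 (Suc m) = pw A (Suc m * g) i j"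
      using x l by (simp add: seq_weight_def add.commute)
    moreover have "(x(Suc m := j)) 0 = i" "(x(Suc m := j)) (Suc m) = j" using x(1) by auto
    ultimately show ?case by metis
  qed
  then show ?thesis using that by blast
qed

lemma seq_weight_1:
  "nonneg_matrix A \<Longrightarrow> seq_weight A 1 x s t = (\<Prod>u\<in>{s..<t}. A $ x u $ x (Suc u))"
  by (simp add: seq_weight_def pw_1)

lemma seq_weight_pos_step:
  assumes "nonneg_matrix A" "0 < seq_weight A g x 0 t" "u < t"
  shows "0 < pw A g (x u) (x (Suc u))"
proof (rule ccontr)
  assume "\<not> ?thesis"
  then have "pw A g (x u) (x (Suc u)) = 0" using pw_nonneg[OF assms(1)] by (metis less_eq_real_def)
  then have "seq_weight A g x 0 t = 0" unfolding seq_weight_def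
    using assms(3) by (intro prod_zero) auto
  then show False using assms(2) by simp
qed

section \<open>Transposition and scaling\<close>

lemma nonneg_matrix_transpose: "nonneg_matrix A \<Longrightarrow> nonneg_matrix (transpose A)"
  by (simp add: nonneg_matrix_def transpose_def)

lemma pw_transpose:
  assumes "nonneg_matrix A"
  shows "pw (transpose A) t i j = pw A t j i"
proof (induction t arbitrary: i)
  case (Suc t)
  note nT = nonneg_matrix_transpose[OF assms]
  show ?case
  proof (rule antisym)
    obtain l where "pw (transpose A) (Suc t) i j = transpose A $ i $ l * pw (transpose A) t l j"
      by (rule pw_Suc_obtain)
    also have "\<dots> = pw A t j l * pw A 1 l i"
      by (simp add: Suc pw_1[OF assms]) (simp add: transpose_def)
    also have "\<dots> \<le> pw A (Suc t) j i" by (rule pw_add_ge') (auto simp: assms)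
    finally show "pw (transpose A) (Suc t) i j \<le> pw A (Suc t) j i" .
  next
    obtain l where "pw A (t + 1) j i = pw A t j l * pw A 1 l i" by (rule pw_add_obtain[OF assms])
    also have "\<dots> = transpose A $ i $ l * pw (transpose A) t l j"
      by (simp add: Suc pw_1[OF assms]) (simp add: transpose_def)
    also have "\<dots> \<le> pw (transpose A) (Suc t) i j" by (rule pw_Suc_ge)
    finally show "pw A (Suc t) j i \<le> pw (transpose A) (Suc t) i j" by simp
  qed
qed (simp add: pw_0 eq_commute)

lemma pw_scale:
  assumes "0 \<le> c"
  shows "pw (c *\<^sub>R A) t i j = c ^ t * pw A t i j"
proof (induction t arbitrary: i)
  case (Suc t)
  have "pw (c *\<^sub>R A) (Suc t) i j = Max (range (\<lambda>l. c ^ Suc t * (A $ i $ l * pw A t l j)))"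
    unfolding pw_Suc by (simp add: Suc ac_simps)
  also have "\<dots> = c ^ Suc t * pw A (Suc t) i j"
  proof -
    have "mono (\<lambda>y. c ^ Suc t * y)" using assms by (intro monoI mult_left_mono) auto
    from mono_Max_commute[OF this, of "range (\<lambda>l. A $ i $ l * pw A t l j)"]
    show ?thesis unfolding pw_Suc by (simp add: image_image)
  qed
  finally show ?case .
qed (simp add: pw_0)

text \<open>The period is a parameter because the same period has to be carried along critical arcs.
  There is no factor \<lambda>(A)^p, as this is applied to normalized matrices.\<close>

definition row_stable :: "real^'n^'n \<Rightarrow> 'n \<Rightarrow> nat \<Rightarrow> nat \<Rightarrow> bool" where
  "row_stable A k p t \<longleftrightarrow> (\<forall>s\<ge>t. \<forall>i. pw A (s + p) k i = pw A s k i)"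

text \<open>The bound at time \<open>t\<close> spreads to later times by splitting walks after
  \<open>t + p\<close> steps; the converse inequality comes from prefixing a closed walk at
  \<open>k\<close> that weighs at least 1.\<close>

lemma row_stableI:
  assumes nn: "nonneg_matrix A" and k: "1 \<le> pw A p k k"
    and le: "\<And>i. pw A (t + p) k i \<le> pw A t k i"
  shows "row_stable A k p t"
  unfolding row_stable_def
proof (intro allI impI antisym)
  fix s i assume "t \<le> s"
  obtain l where l: "pw A ((t + p) + (s - t)) k i = pw A (t + p) k l * pw A (s - t) l i"
    by (rule pw_add_obtain[OF nn])
  have "pw A (s + p) k i = pw A (t + p) k l * pw A (s - t) l i"
    using l \<open>t \<le> s\<close> by (simp add: ac_simps)
  also have "\<dots> \<le> pw A t k l * pw A (s - t) l i" by (intro mult_right_mono le pw_nonneg nn)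
  also have "\<dots> \<le> pw A s k i" by (rule pw_add_ge') (use nn \<open>t \<le> s\<close> in auto)
  finally show "pw A (s + p) k i \<le> pw A s k i" .
  have "pw A s k i \<le> pw A p k k * pw A s k i"
    using mult_right_mono[OF k pw_nonneg[OF nn, of s k i]] by simp
  also have "\<dots> \<le> pw A (s + p) k i" by (rule pw_add_ge') (use nn in auto)
  finally show "pw A s k i \<le> pw A (s + p) k i" .
qed

lemma row_stable_mult:
  assumes "row_stable A k p t" "t \<le> s"
  shows "pw A (s + m * p) k i = pw A s k i"
proof (induction m)
  case (Suc m)
  have "pw A (s + Suc m * p) k i = pw A ((s + m * p) + p) k i" by (simp add: ac_simps)
  also have "\<dots> = pw A (s + m * p) k i" using assms by (simp add: row_stable_def)
  finally show ?case using Suc by simp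
qed simp

text \<open>
  Weights divided by the maximal cycle mean: no closed walk weighs more than 1, and the critical
  arcs are those on closed walks of weight 1. This form of criticality is invariant under
  transposition.
\<close>

definition normalized :: "real^'n^'n \<Rightarrow> bool" where
  "normalized A \<longleftrightarrow> nonneg_matrix A \<and> (\<forall>t i. pw A t i i \<le> 1)"

definition crit :: "real^'n^'n \<Rightarrow> ('n \<times> 'n) set" where
  "crit A = {(i, j). \<exists>t. 1 \<le> A $ i $ j * pw A t j i}"

lemma normalized_nonneg: "normalized A \<Longrightarrow> nonneg_matrix A"
  by (simp add: normalized_def)

lemma crit_pos:
  assumes "normalized A" "(i, j) \<in> crit A"
  shows "0 < A $ i $ j"
proof -
  have "A $ i $ j \<noteq> 0" using assms(2) by (auto simp: crit_def)
  moreover have "0 \<le> A $ i $ j" using assms(1) by (simp add: normalized_def nonneg_matrix_def)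
  ultimately show ?thesis by simp
qed

lemma normalized_transpose: "normalized A \<Longrightarrow> normalized (transpose A)"
  by (simp add: normalized_def nonneg_matrix_transpose pw_transpose)

lemma crit_transpose:
  assumes "normalized A"
  shows "crit (transpose A) = (crit A)\<inverse>"
  using pw_transpose[OF normalized_nonneg[OF assms]] by (auto simp: crit_def transpose_def)

text \<open>Prefix a walk from \<open>k\<close> with turns of a closed critical walk through
  \<open>(k, k')\<close> whose total length is a multiple of \<open>p\<close>: the weight does not
  drop, the walk now starts with that arc, and periodicity of row \<open>k'\<close> removes the
  extra length. So row \<open>k\<close> is a multiple of row \<open>k'\<close> one step
  earlier.\<close>

lemma row_stable_pred:
  assumes A: "normalized A" and e: "(k, k') \<in> crit A" and st: "row_stable A k' p T" and p: "0 < p"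
  shows "row_stable A k p (Suc T)"
proof -
  note nn = normalized_nonneg[OF A]
  obtain t where t: "1 \<le> A $ k $ k' * pw A t k' k" using e by (auto simp: crit_def)
  have a0: "0 < A $ k $ k'" using crit_pos[OF A e] .
  \<comment> \<open>The closed walk through \<open>(k, k')\<close> is run through
    \<open>m + 1\<close> times, its first arc being kept apart.\<close>
  have loop: "1 \<le> A $ k $ k' * pw A (t + m * Suc t) k' k" for m
  proof (induction m)
    case (Suc m)
    have "1 * 1 \<le> (A $ k $ k' * pw A t k' k) * (A $ k $ k' * pw A (t + m * Suc t) k' k)"
      using Suc t by (intro mult_mono) auto
    also have "\<dots> = A $ k $ k' * (pw A t k' k * pw A 1 k k' * pw A (t + m * Suc t) k' k)"
      by (simp add: pw_1[OF nn])
    also have "\<dots> \<le> A $ k $ k' * (pw A (t + 1) k' k' * pw A (t + m * Suc t) k' k)"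
      using a0 by (intro mult_left_mono mult_right_mono pw_add_ge pw_nonneg nn) auto
    also have "\<dots> \<le> A $ k $ k' * pw A (t + Suc m * Suc t) k' k"
      using a0 by (intro mult_left_mono pw_add_ge' nn) (auto simp: ac_simps)
    finally show ?case by simp
  qed (use t in simp)
  \<comment> \<open>\<open>p\<close> turns of length \<open>Suc t\<close> make a multiple of the
    period.\<close>
  define t' where "t' = t + (p - 1) * Suc t"
  have "1 \<le> A $ k $ k' * pw A t' k' k"
    using loop[of "p - 1"] by (simp only: t'_def)
  moreover have "t' + 1 = Suc t * p" using p by (cases p) (auto simp: t'_def)
  ultimately have t': "1 \<le> A $ k $ k' * pw A t' k' k" "t' + 1 = Suc t * p" .
  have eq: "pw A (Suc s) k i = A $ k $ k' * pw A s k' i" if "T \<le> s" for s i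
  proof (rule antisym)
    have "pw A (Suc s) k i \<le> (A $ k $ k' * pw A t' k' k) * pw A (Suc s) k i"
      using mult_right_mono[OF t'(1) pw_nonneg[OF nn, of "Suc s" k i]] by simp
    also have "\<dots> = A $ k $ k' * (pw A t' k' k * pw A (Suc s) k i)" by simp
    also have "\<dots> \<le> A $ k $ k' * pw A (s + Suc t * p) k' i"
      using a0 t'(2) by (intro mult_left_mono pw_add_ge' nn) (auto simp: ac_simps)
    also have "\<dots> = A $ k $ k' * pw A s k' i" using row_stable_mult[OF st that, of "Suc t"] by (simp only:)
    finally show "pw A (Suc s) k i \<le> A $ k $ k' * pw A s k' i" .
  qed (rule pw_Suc_ge)
  show ?thesis unfolding row_stable_def
  proof (intro allI impI)
    fix s i assume "Suc T \<le> s"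
    then obtain s' where s: "s = Suc s'" "T \<le> s'" by (cases s) auto
    have "pw A (s + p) k i = A $ k $ k' * pw A (s' + p) k' i" using eq[of "s' + p" i] s by simp
    also have "\<dots> = A $ k $ k' * pw A s' k' i" using st s by (simp add: row_stable_def)
    also have "\<dots> = pw A s k i" using eq[of s' i] s by simp
    finally show "pw A (s + p) k i = pw A s k i" .
  qed
qed

lemma row_stable_path:
  assumes A: "normalized A" and p: "0 < p"
    and e: "\<And>u. u < L \<Longrightarrow> (y u, y (Suc u)) \<in> crit A" and st: "row_stable A (y L) p T"
  shows "row_stable A (y 0) p (T + L)"
  using e st
proof (induction L arbitrary: T)
  case (Suc L)
  have "row_stable A (y L) p (Suc T)"
    using row_stable_pred[OF A Suc.prems(1) Suc.prems(2) p] by simp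
  then show ?case using Suc.IH[of "Suc T"] Suc.prems(1) by simp
qed simp

text \<open>\<open>N\<close> will be the cyclic class of \<open>k\<close>. Among the
  \<open>m + 1\<close> nodes met at multiples of \<open>g\<close> two coincide, and the closed part
  between them weighs at most 1, so it can be cut out.\<close>

lemma row_stable_class:
  fixes A :: "real^'n^'n"
  assumes A: "normalized A" and g: "1 \<le> pw A g k k"
    and N: "\<And>m i. 0 < pw A (m * g) k i \<Longrightarrow> i \<in> N" and m: "card N = m"
  shows "row_stable A k g (g * (m - 1))"
proof (rule row_stableI)
  note nn = normalized_nonneg[OF A]
  have kpow: "1 \<le> pw A (u * g) k k" for u
  proof (induction u)
    case (Suc u)
    have "1 * 1 \<le> pw A g k k * pw A (u * g) k k" using Suc g by (intro mult_mono) auto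
    also have "\<dots> \<le> pw A (Suc u * g) k k" by (rule pw_add_ge') (auto simp: nn)
    finally show ?case by simp
  qed (simp add: pw_0)
  have "k \<in> N" using N[of 1 k] g by simp
  then have "0 < m" using m by (metis card_gt_0_iff empty_iff finite)
  fix i
  have "pw A (m * g) k i \<le> pw A ((m - 1) * g) k i"
  proof (cases "0 < pw A (m * g) k i")
    case True
    then obtain x where x: "x 0 = k" "x m = i" "pw A (m * g) k i = seq_weight A g x 0 m"
      using pw_seq_obtain[OF nn] by blast
    have xN: "x u \<in> N" if "u \<le> m" for u
    proof (rule N)
      have "0 < seq_weight A g x 0 u * seq_weight A g x u m"
        using True x(3) seq_weight_split[of 0 u m A g x] that by simp
      then have "0 < seq_weight A g x 0 u" using seq_weight_nonneg[OF nn]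
        by (metis less_eq_real_def mult_eq_0_iff)
      also have "\<dots> \<le> pw A (u * g) k (x u)" using seq_weight_le_pw[OF nn, of 0 u g x] x by simp
      finally show "0 < pw A (u * g) k (x u)" .
    qed
    have "\<not> inj_on x {..m}"
    proof
      assume "inj_on x {..m}"
      then have "card {..m} \<le> card N" using xN by (intro card_inj_on_le[of x]) auto
      then show False using m by simp
    qed
    then obtain s t where st: "s < t" "t \<le> m" "x s = x t"
      unfolding inj_on_def by (metis atMost_iff linorder_neqE_nat)
    let ?w = "seq_weight A g x"
    have "pw A (m * g) k i = ?w 0 s * ?w s t * ?w t m"
      using x(3) st seq_weight_split[of 0 s m A g x] seq_weight_split[of s t m A g x] by simp
    also have "\<dots> \<le> pw A (s * g) k (x s) * 1 * pw A ((m - t) * g) (x s) i"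
    proof (intro mult_mono)
      show "?w 0 s \<le> pw A (s * g) k (x s)" using seq_weight_le_pw[OF nn, of 0 s g x] x by simp
      have "?w s t \<le> pw A ((t - s) * g) (x s) (x s)"
        using seq_weight_le_pw[OF nn, of s t g x] st by simp
      also have "\<dots> \<le> 1" using A by (simp add: normalized_def)
      finally show "?w s t \<le> 1" .
      show "?w t m \<le> pw A ((m - t) * g) (x s) i" using seq_weight_le_pw[OF nn, of t m g x] st x by simp
    qed (auto simp: seq_weight_nonneg nn pw_nonneg)
    also have "\<dots> \<le> pw A (s * g + (m - t) * g) k i" by (simp add: pw_add_ge nn)
    \<comment> \<open>Cutting removed \<open>t - s\<close> blocks of \<open>g\<close> steps, but
      only one has to go: loops at \<open>k\<close>, put in front, refill the other
      \<open>t - s - 1\<close>.\<close>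
    also have "\<dots> \<le> pw A ((t - s - 1) * g) k k * pw A (s * g + (m - t) * g) k i"
      using mult_right_mono[OF kpow pw_nonneg[OF nn]] by simp
    also have "\<dots> \<le> pw A ((m - 1) * g) k i"
    proof (rule pw_add_ge'[OF nn])
      have "(t - s - 1) + (s + (m - t)) = m - 1" using st by auto
      then show "(t - s - 1) * g + (s * g + (m - t) * g) = (m - 1) * g"
        by (metis add_mult_distrib)
    qed
    finally show ?thesis .
  next
    case False
    then show ?thesis using pw_nonneg[OF nn, of "(m - 1) * g" k i] by linarith
  qed
  moreover have "g * (m - 1) + g = m * g" using \<open>0 < m\<close>
    by (metis Suc_pred' add.commute mult.commute mult_Suc)
  ultimately show "pw A (g * (m - 1) + g) k i \<le> pw A (g * (m - 1)) k i" by (simp add: mult.commute)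
qed (use A g in \<open>auto simp: normalized_def\<close>)

section \<open>Walks around a Hamiltonian cycle\<close>

lemma pigeonhole_mod:
  fixes f :: "nat \<Rightarrow> int"
  assumes "0 < q"
  obtains i j where "i < j" "j \<le> q" "[f i = f j] (mod int q)"
proof -
  have "(\<lambda>j. f j mod int q) ` {..q} \<subseteq> {0..<int q}" using assms by auto
  then have "card ((\<lambda>j. f j mod int q) ` {..q}) \<le> card {0..<int q}" by (intro card_mono) auto
  then have "card ((\<lambda>j. f j mod int q) ` {..q}) < card {..q}" by simp
  then have "\<not> inj_on (\<lambda>j. f j mod int q) {..q}" by (rule pigeonhole)
  then obtain i j where "i \<le> q" "j \<le> q" "i \<noteq> j" "f i mod int q = f j mod int q"
    unfolding inj_on_def by auto
  then show ?thesis using that[of i j] that[of j i] unfolding cong_def by (metis linorder_neqE_nat)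
qed

text \<open>
  A shortest submultiset with the same sum modulo \<open>q\<close> has no nonempty zero-sum submultiset, hence
  at most \<open>q - 1\<close> elements; if it has \<open>q - 1\<close> of them, exchanging the first two in an enumeration
  does not change the set of partial sums, so that they are equal.
\<close>

lemma zero_sum_reduction:
  fixes M :: "int multiset"
  assumes q: "2 \<le> q" and M: "set_mset M \<subseteq> {0..<int q}"
  obtains N where "N \<subseteq># M" "[\<Sum>\<^sub># N = \<Sum>\<^sub># M] (mod int q)"
    "size N \<le> q - 2 \<or> (\<exists>c. 0 < c \<and> c < int q \<and> N = replicate_mset (q - 1) c)"
proof -
  let ?P = "\<lambda>N. N \<subseteq># M \<and> [\<Sum>\<^sub># N = \<Sum>\<^sub># M] (mod int q)"
  have "?P M" by simp
  from ex_has_least_nat[of ?P, OF this, of size]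
  obtain N where N: "?P N" and least: "\<And>K. ?P K \<Longrightarrow> size N \<le> size K" by blast
  \<comment> \<open>Dropping a zero-sum part would leave a smaller submultiset with the same
    sum.\<close>
  have nz: "\<not> [\<Sum>\<^sub># K = 0] (mod int q)" if "K \<subseteq># N" "K \<noteq> {#}" for K
  proof
    assume K: "[\<Sum>\<^sub># K = 0] (mod int q)"
    obtain K' where K': "N = K + K'" using \<open>K \<subseteq># N\<close> by (auto simp: mset_subset_eq_exists_conv)
    have "[\<Sum>\<^sub># K' = \<Sum>\<^sub># N] (mod int q)"
      using cong_add[OF K cong_refl[of "\<Sum>\<^sub># K'"]] K' by (simp add: cong_sym_eq)
    moreover have "K' \<subseteq># M" 
      by (rule subset_mset.order_trans[OF _ conjunct1[OF N]]) (simp add: K')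
    ultimately have "size N \<le> size K'" using N by (intro least) (auto intro: cong_trans)
    then show False using K' \<open>K \<noteq> {#}\<close> by (simp add: nonempty_has_size)
  qed
  \<comment> \<open>Congruent prefix sums would enclose a zero-sum segment.\<close>
  have seg: "\<not> [sum_list (take i xs) = sum_list (take j xs)] (mod int q)"
    if "mset xs = N" "i < j" "j \<le> length xs" for xs i j
  proof
    assume *: "[sum_list (take i xs) = sum_list (take j xs)] (mod int q)"
    define vs where "vs = drop i (take j xs)"
    have t: "take j xs = take i xs @ vs"
      using append_take_drop_id[of i "take j xs"] \<open>i < j\<close> by (simp add: vs_def)
    have "[sum_list vs = 0] (mod int q)" using * by (simp add: t cong_iff_dvd_diff)
    moreover have "mset vs \<subseteq># N"
    proof -
      have "xs = (take i xs @ vs) @ drop j xs" using append_take_drop_id[of j xs] t by simp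
      then have "mset xs = mset ((take i xs @ vs) @ drop j xs)" by (rule arg_cong)
      then show ?thesis using that(1) by simp
    qed
    moreover have "mset vs \<noteq> {#}" using that by (simp add: vs_def)
    ultimately show False using nz[of "mset vs"] by (simp add: sum_mset_sum_list)
  qed
  show ?thesis
  proof (cases "size N \<le> q - 2")
    case True
    then show ?thesis using N that by blast
  next
    case False
    have eq: "a = b" if ab: "{#a, b#} \<subseteq># N" for a b
    proof (rule ccontr)
      assume "a \<noteq> b"
      obtain K where K: "N = {#a, b#} + K" using ab by (auto simp: mset_subset_eq_exists_conv)
      obtain R where R: "mset R = K" using ex_mset by blast
      let ?xs = "a # b # R"
      have xs: "mset ?xs = N" by (simp add: K R)
      have "length ?xs = size N" by (simp add: xs[symmetric])
      then have len: "q - 1 \<le> length ?xs" using False by linarith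
      \<comment> \<open>The values at \<open>0, ..., q - 1\<close> are prefix sums, pairwise
        incongruent by \<open>seg\<close>. The extra value at \<open>q\<close> is the first partial
        sum after exchanging \<open>a\<close> and \<open>b\<close>; by pigeonhole it agrees with one
        of them.\<close>
      define f where "f j = (if j = q then b else sum_list (take j ?xs))" for j
      obtain i j where ij: "i < j" "j \<le> q" "[f i = f j] (mod int q)"
        using pigeonhole_mod[of q f] q by auto
      show False
      proof (cases "j < q")
        case True
        then have "j \<le> length ?xs" using len by linarith
        from seg[OF xs ij(1) this] show False using ij True by (simp add: f_def del: take_Cons)
      next
        case False
        then have c: "[sum_list (take i ?xs) = b] (mod int q)" "i < q"
          using ij by (auto simp: f_def simp del: take_Cons)
        consider "i = 0" | "i = 1" | r where "i = Suc (Suc r)" by (metis One_nat_def not0_implies_Suc)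
        then show False
        proof cases
          case 1
          then have "[\<Sum>\<^sub># {#b#} = 0] (mod int q)" using c by (simp add: cong_sym_eq)
          then show False using nz[of "{#b#}"] by (simp add: K)
        next
          case 2
          then have "[a = b] (mod int q)" using c by simp
          moreover have "a \<in># N" "b \<in># N" by (auto simp: K)
          then have "a \<in> {0..<int q}" "b \<in> {0..<int q}" using M N by (blast dest: mset_subset_eqD)+
          ultimately have "a = b" by (auto simp: cong_def)
          then show False using \<open>a \<noteq> b\<close> by simp
        next
          case 3
          then have "[a + sum_list (take r R) = 0] (mod int q)" using c
            by (simp add: cong_iff_dvd_diff algebra_simps)
          then have "[\<Sum>\<^sub># (mset (a # take r R)) = 0] (mod int q)" by (simp add: sum_mset_sum_list)
          moreover have "mset (a # take r R) \<subseteq># N"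
          proof -
            have "mset R = mset (take r R) + mset (drop r R)"
              unfolding mset_append[symmetric] append_take_drop_id ..
            then have "N = mset (a # take r R) + mset (b # drop r R)" by (simp add: K R[symmetric])
            then show ?thesis by simp
          qed
          ultimately show False using nz[of "mset (a # take r R)"] by simp
        qed
      qed
    qed
    obtain xs where xs: "mset xs = N" using ex_mset by blast
    \<comment> \<open>\<open>q\<close> elements would give \<open>q + 1\<close> prefix sums, two of
      them congruent.\<close>
    have "size N \<le> q - 1"
    proof (rule ccontr)
      assume "\<not> ?thesis"
      moreover have "length xs = size N" by (simp add: xs[symmetric])
      ultimately have "q \<le> length xs" by linarith
      moreover obtain i j where "i < j" "j \<le> q" "[sum_list (take i xs) = sum_list (take j xs)] (mod int q)"
        using pigeonhole_mod[of q "\<lambda>i. sum_list (take i xs)"] q by auto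
      ultimately show False using seg[OF xs, of i j] by simp
    qed
    then have size: "size N = q - 1" using False by linarith
    then have "N \<noteq> {#}" using q by auto
    then obtain c where c: "c \<in># N" by blast
    have "set_mset N \<subseteq> {c}"
    proof
      fix b assume b: "b \<in># N"
      obtain N' where N': "N = add_mset c N'" using c by (rule mset_add)
      have "b = c" if "b \<in># N'"
      proof -
        obtain N'' where "N' = add_mset b N''" using \<open>b \<in># N'\<close> by (rule mset_add)
        then show ?thesis using eq[of c b] N' by simp
      qed
      then show "b \<in> {c}" using b N' by auto
    qed
    then have "N = replicate_mset (size N) c" by (rule set_mset_subset_singletonD)
    then have "N = replicate_mset (q - 1) c" by (simp only: size)
    moreover have "c \<in> {0..<int q}" using N M c by (blast dest: mset_subset_eqD)
    moreover have "c \<noteq> 0" using nz[of "{#c#}"] c by auto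
    ultimately have "\<exists>c. 0 < c \<and> c < int q \<and> N = replicate_mset (q - 1) c"
      by (intro exI[of _ c]) auto
    then show ?thesis using that[of N] N by blast
  qed
qed

text \<open>
  \<open>G t u v\<close> is the best weight of a walk of length \<open>t\<close> from \<open>u\<close> to \<open>v\<close> on the integers modulo \<open>q\<close>,
  where the steps from \<open>u\<close> to \<open>u + 1\<close> weigh 1 and all others at most 1. An arc from \<open>u\<close> to
  \<open>u + 1 + c\<close> is a jump by \<open>c\<close> in the frame rotating along with the cycle. In this frame a walk is
  determined by its jumps, which can be rearranged and delayed at no cost.
\<close>

locale rotating_frame =
  fixes q :: nat and G :: "nat \<Rightarrow> int \<Rightarrow> int \<Rightarrow> real"
  assumes q2: "2 \<le> q"
    and G_mult: "G s u v * G t v w \<le> G (s + t) u w"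
    and G_nonneg: "0 \<le> G t u v" and G_le_1: "G t u v \<le> 1"
    and G_rot: "[u + int t = v] (mod int q) \<Longrightarrow> 1 \<le> G t u v"
    and G_cong: "[u = u'] (mod int q) \<Longrightarrow> [v = v'] (mod int q) \<Longrightarrow> G t u v = G t u' v'"
begin

text \<open>Maximizing over the start node makes the bound on a jump independent of when it is made,
  so that jumps may be reordered.\<close>

definition jump_weight :: "int \<Rightarrow> real" where
  "jump_weight c = Max ((\<lambda>u. G 1 u (u + 1 + c)) ` {0..<int q})"

lemma jump_weight_ge: "G 1 u (u + 1 + c) \<le> jump_weight c"
proof -
  have "G 1 u (u + 1 + c) = G 1 (u mod int q) (u mod int q + 1 + c)"
    by (intro G_cong cong_add) (auto simp: cong_def)
  also have "\<dots> \<le> jump_weight c" unfolding jump_weight_def using q2 by (intro Max_ge) auto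
  finally show ?thesis .
qed

lemma jump_weight_obtain:
  obtains u where "jump_weight c = G 1 u (u + 1 + c)"
proof -
  have "jump_weight c \<in> (\<lambda>u. G 1 u (u + 1 + c)) ` {0..<int q}"
    unfolding jump_weight_def using q2 by (intro Max_in) auto
  then show ?thesis using that by auto
qed

lemma jump_weight_nonneg: "0 \<le> jump_weight c"
  using jump_weight_ge[of 0 c] G_nonneg[of 1 0 "0 + 1 + c"] by linarith

lemma jump_weight_le_1: "jump_weight c \<le> 1"
  using jump_weight_obtain[of c] G_le_1 by metis

definition jumps_weight :: "int multiset \<Rightarrow> real" where
  "jumps_weight N = \<Prod>\<^sub># (image_mset jump_weight N)"

lemma jumps_weight_simps [simp]:
  "jumps_weight {#} = 1"
  "jumps_weight (add_mset c N) = jump_weight c * jumps_weight N"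
  "jumps_weight (N + N') = jumps_weight N * jumps_weight N'"
  by (simp_all add: jumps_weight_def)

lemma jumps_weight_nonneg: "0 \<le> jumps_weight N"
  by (induction N) (auto simp: jump_weight_nonneg)

lemma jumps_weight_le_1: "jumps_weight N \<le> 1"
  by (induction N) (auto simp: jump_weight_nonneg jump_weight_le_1 jumps_weight_nonneg mult_le_one)

lemma jumps_weight_antimono: "N \<subseteq># M \<Longrightarrow> jumps_weight M \<le> jumps_weight N"
  using mult_left_mono[OF jumps_weight_le_1 jumps_weight_nonneg]
  by (metis jumps_weight_simps(3) mult.right_neutral subset_mset.add_diff_inverse)

text \<open>Read: some walk of length \<open>t\<close> is at least as heavy as making each jump of
  \<open>N\<close> where it weighs most; spare steps can follow the cycle for free.\<close>

definition realizes :: "nat \<Rightarrow> int \<Rightarrow> int multiset \<Rightarrow> bool" where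
  "realizes t u N \<longleftrightarrow> jumps_weight N \<le> G t u (u + int t + \<Sum>\<^sub># N)"

lemma realizes_empty: "realizes t u {#}"
  by (simp add: realizes_def G_rot)

lemma realizes_add:
  assumes "realizes s u N" "realizes t v N'" "[u + int s + \<Sum>\<^sub># N = v] (mod int q)"
  shows "realizes (s + t) u (N + N')"
proof -
  have "jumps_weight (N + N') \<le> G s u (u + int s + \<Sum>\<^sub># N) * G t v (v + int t + \<Sum>\<^sub># N')"
    using assms(1,2) by (auto simp: realizes_def intro!: mult_mono jumps_weight_nonneg G_nonneg)
  also have "G s u (u + int s + \<Sum>\<^sub># N) = G s u v" using assms(3) by (intro G_cong) auto
  also have "G s u v * G t v (v + int t + \<Sum>\<^sub># N') \<le> G (s + t) u (v + int t + \<Sum>\<^sub># N')" by (rule G_mult)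
  also have "\<dots> = G (s + t) u (u + int (s + t) + \<Sum>\<^sub># (N + N'))"
  proof (rule G_cong)
    have "[(u + int s + \<Sum>\<^sub># N) + (int t + \<Sum>\<^sub># N') = v + (int t + \<Sum>\<^sub># N')] (mod int q)"
      using assms(3) by (rule cong_add) simp
    then show "[v + int t + \<Sum>\<^sub># N' = u + int (s + t) + \<Sum>\<^sub># (N + N')] (mod int q)"
      by (simp add: cong_sym_eq ac_simps)
  qed simp
  finally show ?thesis by (simp add: realizes_def)
qed

lemma realizes_mono:
  assumes "realizes t u N" "t \<le> w"
  shows "realizes w u N"
  using realizes_add[OF assms(1) realizes_empty[of "w - t"] cong_refl] assms(2) by simp

lemma wait_for:
  obtains s where "s \<le> q - 1" "[u + int s = v] (mod int q)"
proof
  have "0 \<le> (v - u) mod int q" "(v - u) mod int q < int q" using q2 by auto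
  then show "nat ((v - u) mod int q) \<le> q - 1" by linarith
  show "[u + int (nat ((v - u) mod int q)) = v] (mod int q)"
    using \<open>0 \<le> (v - u) mod int q\<close> by (simp add: cong_def mod_simps)
qed

lemma realizes_single:
  assumes "jump_weight c = G 1 u (u + 1 + c)"
  shows "realizes 1 u {#c#}"
  using assms by (simp add: realizes_def)

lemma realizes_wait:
  assumes "realizes t v N" "[u + int s = v] (mod int q)"
  shows "realizes (s + t) u N"
  using realizes_add[OF realizes_empty[of s u] assms(1)] assms(2) by simp

text \<open>Each jump takes at most \<open>q - 1\<close> steps of waiting for its best node and one
  step for itself.\<close>

lemma realizes_all: "realizes (q * size N) u N"
proof (induction N arbitrary: u)
  case empty
  show ?case by (rule realizes_empty)
next
  case (add c N)
  obtain v where v: "jump_weight c = G 1 v (v + 1 + c)" by (rule jump_weight_obtain)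
  obtain s where s: "s \<le> q - 1" "[u + int s = v] (mod int q)" by (rule wait_for)
  have "realizes (s + 1) u {#c#}" by (rule realizes_wait[OF realizes_single[OF v] s(2)])
  then have "realizes q u {#c#}" using s q2 by (elim realizes_mono) auto
  from realizes_add[OF this add.IH cong_refl] show ?case by (simp add: ac_simps)
qed

text \<open>
  After a jump by \<open>c\<close> from \<open>v\<close>, the walk is back at \<open>v\<close> after waiting only \<open>q - 1 - c\<close> steps.
\<close>

lemma realizes_replicate:
  assumes "0 < c" "c < int q"
  shows "realizes (q + r * (q - 1)) u (replicate_mset (Suc r) c)"
proof -
  obtain v where v: "jump_weight c = G 1 v (v + 1 + c)" by (rule jump_weight_obtain)
  define e where "e = nat (int q - 1 - c)"
  have e: "int e = int q - 1 - c" using assms by (simp add: e_def)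
  have main: "realizes (r * (1 + e) + 1) v (replicate_mset (Suc r) c)"
  proof (induction r)
    case 0
    show ?case using realizes_single[OF v] by simp
  next
    case (Suc r)
    have "[v + int 1 + \<Sum>\<^sub># {#c#} + int e = v] (mod int q)" by (simp add: e cong_def)
    from realizes_add[OF realizes_single[OF v] realizes_wait[OF Suc this] cong_refl]
    show ?case by (simp add: ac_simps)
  qed
  obtain s where s: "s \<le> q - 1" "[u + int s = v] (mod int q)" by (rule wait_for)
  \<comment> \<open>As \<open>c\<close> is at least 1, each repetition takes
    \<open>1 + e = q - c \<le> q - 1\<close> steps; only the first jump may have to wait for
    \<open>q - 1\<close> steps.\<close>
  have "r * (1 + e) \<le> r * (q - 1)" using e assms by (intro mult_le_mono2) linarith
  then have "s + (r * (1 + e) + 1) \<le> q + r * (q - 1)" using s q2 by linarith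
  then show ?thesis using realizes_wait[OF main s(2)] by (rule realizes_mono[rotated])
qed

text \<open>The jumps of the long walk are thinned out by \<open>zero_sum_reduction\<close>; fewer
  jumps weigh no less, and those that remain fit into \<open>w\<close> steps. As \<open>t\<close>
  and \<open>w\<close> are congruent modulo \<open>q\<close>, the endpoint is kept.\<close>

lemma long_walk_shortened:
  assumes w: "w = (q - 1)\<^sup>2 + 1" and t: "[int t = int w] (mod int q)"
  shows "(\<Prod>s\<in>{0..<t}. G 1 (y s) (y (Suc s))) \<le> G w (y 0) (y t)"
proof -
  define c where "c s = (y (Suc s) - y s - 1) mod int q" for s
  define M where "M m = image_mset c (mset_set {0..<m})" for m
  have M_Suc: "M (Suc m) = add_mset (c m) (M m)" for m
    by (simp add: M_def atLeast0_lessThan_Suc)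
  have "(\<Prod>s\<in>{0..<m}. G 1 (y s) (y (Suc s))) \<le> jumps_weight (M m)" for m
  proof (induction m)
    case (Suc m)
    have "G 1 (y m) (y (Suc m)) = G 1 (y m) (y m + 1 + c m)"
      by (rule G_cong) (auto simp: c_def cong_def mod_simps)
    also have "\<dots> \<le> jump_weight (c m)" by (rule jump_weight_ge)
    finally have "G 1 (y m) (y (Suc m)) \<le> jump_weight (c m)" .
    with Suc have "(\<Prod>s\<in>{0..<m}. G 1 (y s) (y (Suc s))) * G 1 (y m) (y (Suc m))
        \<le> jumps_weight (M m) * jump_weight (c m)"
      by (intro mult_mono jumps_weight_nonneg G_nonneg)
    then show ?case by (simp add: M_Suc mult.commute)
  qed (simp add: M_def)
  then have "(\<Prod>s\<in>{0..<t}. G 1 (y s) (y (Suc s))) \<le> jumps_weight (M t)" .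
  moreover have yM: "[y m = y 0 + int m + \<Sum>\<^sub># (M m)] (mod int q)" for m
  proof (induction m)
    case (Suc m)
    have "[y m + (1 + (y (Suc m) - y m - 1)) = (y 0 + int m + \<Sum>\<^sub># (M m)) + (1 + c m)] (mod int q)"
      using Suc by (intro cong_add) (auto simp: c_def cong_def mod_simps)
    then show ?case by (simp add: M_Suc ac_simps)
  qed (simp add: M_def)
  moreover have "set_mset (M t) \<subseteq> {0..<int q}" using q2 by (auto simp: M_def c_def)
  then obtain N where N: "N \<subseteq># M t" "[\<Sum>\<^sub># N = \<Sum>\<^sub># (M t)] (mod int q)"
    "size N \<le> q - 2 \<or> (\<exists>c. 0 < c \<and> c < int q \<and> N = replicate_mset (q - 1) c)"
    using zero_sum_reduction[OF q2] by metis
  moreover have "realizes w (y 0) N"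
    using N(3)
  proof
    obtain e where e: "q = Suc (Suc e)" using q2 by (metis add_2_eq_Suc le_Suc_ex)
    { assume "size N \<le> q - 2"
      then have "q * size N \<le> q * (q - 2)" by simp
      also have "\<dots> \<le> w" using w by (simp add: e power2_eq_square)
      finally show ?thesis using realizes_all by (rule realizes_mono[rotated]) }
    assume "\<exists>c. 0 < c \<and> c < int q \<and> N = replicate_mset (q - 1) c"
    then obtain c where "0 < c" "c < int q" "N = replicate_mset (q - 1) c" by blast
    then have "realizes (q + (q - 2) * (q - 1)) (y 0) N"
      using realizes_replicate[of c "q - 2" "y 0"] by (simp add: e)
    \<comment> \<open>The extreme case of \<open>q - 1\<close> equal jumps needs exactly
      \<open>(q - 1)^2 + 1\<close> steps in this estimate, which is where the Wielandt number comes
      from.\<close>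
    moreover have "q + (q - 2) * (q - 1) = w" using w by (simp add: e power2_eq_square)
    ultimately show ?thesis by simp
  qed
  ultimately have "(\<Prod>s\<in>{0..<t}. G 1 (y s) (y (Suc s))) \<le> G w (y 0) (y 0 + int w + \<Sum>\<^sub># N)"
    using jumps_weight_antimono[OF N(1)] by (simp add: realizes_def)
  also have "\<dots> = G w (y 0) (y t)"
  proof (rule G_cong)
    have "[y 0 + int t + \<Sum>\<^sub># (M t) = y 0 + int w + \<Sum>\<^sub># N] (mod int q)"
      using t N(2) by (intro cong_add) (auto simp: cong_sym_eq)
    then show "[y 0 + int w + \<Sum>\<^sub># N = y t] (mod int q)"
      using yM[of t] by (metis cong_sym cong_trans)
  qed simp
  finally show ?thesis .
qed

end

section \<open>Critical cycles\<close>

text \<open>With integer indices, reversing the cycle for the transposed matrix is just \<open>u \<mapsto> - u\<close>.\<close>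

locale critical_cycle_seq =
  fixes A :: "real^'n^'n" and z :: "int \<Rightarrow> 'n" and g :: nat
  assumes normalized: "normalized A" and g_pos: "0 < g"
    and z_eq: "z u = z v \<longleftrightarrow> [u = v] (mod int g)"
    and z_crit: "(z u, z (u + 1)) \<in> crit A"
begin

lemmas nn = normalized_nonneg[OF normalized]

definition cyc_weight :: "int \<Rightarrow> nat \<Rightarrow> real" where
  "cyc_weight u t = (\<Prod>e<t. A $ z (u + int e) $ z (u + int e + 1))"

lemma cyc_weight_Suc: "cyc_weight u (Suc t) = cyc_weight u t * A $ z (u + int t) $ z (u + int t + 1)"
  by (simp add: cyc_weight_def)

lemma cyc_weight_pos: "0 < cyc_weight u t"
  unfolding cyc_weight_def by (intro prod_pos ballI crit_pos[OF normalized z_crit])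

text \<open>Each critical arc comes with its own return walk; concatenating these backwards yields
  one for a whole stretch of the cycle. This is the way from single arcs, of which
  \<open>crit\<close> speaks, to the weight of the cycle.\<close>

lemma cyc_weight_return: "\<exists>t'. 1 \<le> cyc_weight u t * pw A t' (z (u + int t)) (z u)"
proof (induction t)
  case 0
  show ?case by (rule exI[of _ 0]) (simp add: cyc_weight_def pw_0)
next
  case (Suc t)
  let ?a = "A $ z (u + int t) $ z (u + int t + 1)"
  obtain t' where t': "1 \<le> cyc_weight u t * pw A t' (z (u + int t)) (z u)" using Suc by blast
  obtain s where s: "1 \<le> ?a * pw A s (z (u + int t + 1)) (z (u + int t))"
    using z_crit[of "u + int t"] by (auto simp: crit_def)
  have "1 * 1 \<le> (cyc_weight u t * pw A t' (z (u + int t)) (z u)) * (?a * pw A s (z (u + int t + 1)) (z (u + int t)))"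
    using t' s by (intro mult_mono) auto
  also have "\<dots> = cyc_weight u (Suc t) * (pw A s (z (u + int t + 1)) (z (u + int t)) * pw A t' (z (u + int t)) (z u))"
    by (simp add: cyc_weight_Suc)
  also have "\<dots> \<le> cyc_weight u (Suc t) * pw A (s + t') (z (u + int t + 1)) (z u)"
    using cyc_weight_pos[of u "Suc t"] by (intro mult_left_mono pw_add_ge nn) auto
  finally show ?case by (auto simp: ac_simps)
qed

lemma cyc_weight_le_pw: "cyc_weight u t \<le> pw A t (z u) (z (u + int t))"
proof (induction t)
  case (Suc t)
  have "cyc_weight u (Suc t) \<le> pw A t (z u) (z (u + int t)) * pw A 1 (z (u + int t)) (z (u + int t + 1))"
    using Suc crit_pos[OF normalized z_crit, of "u + int t"]
    by (auto simp: cyc_weight_Suc pw_1[OF nn] intro!: mult_right_mono)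
  also have "\<dots> \<le> pw A (Suc t) (z u) (z (u + int t + 1))" by (intro pw_add_ge' nn) simp
  finally show ?case by (simp add: ac_simps)
qed (simp add: cyc_weight_def pw_0)

lemma z_period: "z (u + int g) = z u" "z (u mod int g) = z u"
  by (simp_all add: z_eq cong_def)

text \<open>A full turn is closed and so weighs at most 1. The return walk attached to it is then
  closed as well and weighs at most 1, which forces the turn to weigh at least 1.\<close>

lemma cyc_weight_period: "cyc_weight u g = 1"
proof (rule antisym)
  have loop: "pw A t (z u) (z u) \<le> 1" for t using normalized by (simp add: normalized_def)
  have "cyc_weight u g \<le> pw A g (z u) (z u)" using cyc_weight_le_pw[of u g] by (simp add: z_period)
  then show "cyc_weight u g \<le> 1" using loop[of g] by linarith
  obtain t' where "1 \<le> cyc_weight u g * pw A t' (z u) (z u)"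
    using cyc_weight_return[of u g] by (auto simp: z_period)
  also have "\<dots> \<le> cyc_weight u g * 1" using cyc_weight_pos[of u g] loop by (intro mult_left_mono) auto
  finally show "1 \<le> cyc_weight u g" by simp
qed

lemma loop_weight: "1 \<le> pw A g (z u) (z u)"
  using cyc_weight_le_pw[of u g] by (simp add: z_period cyc_weight_period)

text \<open>As a diagonal scaling this gives every arc of the cycle weight 1. Reduction modulo
  \<open>g\<close> is consistent since a full turn weighs 1.\<close>

definition potential :: "int \<Rightarrow> real" where
  "potential u = cyc_weight 0 (nat (u mod int g))"

lemma potential_pos: "0 < potential u"
  by (simp add: potential_def cyc_weight_pos)

lemma potential_cong: "[u = v] (mod int g) \<Longrightarrow> potential u = potential v"
  by (simp add: potential_def cong_def)

lemma potential_step: "potential (u + 1) = potential u * A $ z u $ z (u + 1)"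
proof -
  define m where "m = nat (u mod int g)"
  have m: "int m = u mod int g" "m < g" using g_pos by (auto simp: m_def nat_less_iff)
  have "z (int m) = z u" "z (int m + 1) = z (u + 1)" by (simp_all add: m z_eq cong_def mod_simps)
  then have *: "cyc_weight 0 (Suc m) = potential u * A $ z u $ z (u + 1)"
    using cyc_weight_Suc[of 0 m] by (simp add: potential_def m_def)
  have "potential (u + 1) = potential (int (Suc m))"
    by (rule potential_cong) (simp add: m cong_def mod_simps add.commute)
  also have "\<dots> = cyc_weight 0 (Suc m)"
  \<comment> \<open>At the wrap-around the potential restarts at 1, in agreement with the weight of
    a full turn.\<close>
  proof (cases "Suc m = g")
    case True
    then show ?thesis by (simp only: potential_def cyc_weight_period) (simp add: cyc_weight_def)
  next
    case False
    then have "Suc m < g" using m by simp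
    then have "nat (int (Suc m) mod int g) = Suc m" by (simp only: zmod_int[symmetric]) simp
    then show ?thesis by (simp only: potential_def)
  qed
  finally show ?thesis using * by simp
qed

lemma potential_le_pw: "potential (u + int t) \<le> potential u * pw A t (z u) (z (u + int t))"
proof (induction t)
  case (Suc t)
  have "potential (u + int (Suc t)) = potential (u + int t) * A $ z (u + int t) $ z (u + int t + 1)"
    using potential_step[of "u + int t"] by (simp add: ac_simps)
  also have "\<dots> \<le> potential u * pw A t (z u) (z (u + int t)) * pw A 1 (z (u + int t)) (z (u + int t + 1))"
    using Suc crit_pos[OF normalized z_crit, of "u + int t"]
    by (auto simp: pw_1[OF nn] intro!: mult_right_mono)
  also have "\<dots> = potential u * (pw A t (z u) (z (u + int t)) * pw A 1 (z (u + int t)) (z (u + int t + 1)))" by simp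
  also have "\<dots> \<le> potential u * pw A (Suc t) (z u) (z (u + int t + 1))"
    using potential_pos[of u] by (intro mult_left_mono pw_add_ge' nn) auto
  finally show ?case by (simp add: ac_simps)
qed (simp add: pw_0)

definition scaled :: "nat \<Rightarrow> int \<Rightarrow> int \<Rightarrow> real" where
  "scaled t u v = pw A t (z u) (z v) * potential u / potential v"

lemma scaled_nonneg: "0 \<le> scaled t u v"
  unfolding scaled_def using potential_pos by (intro divide_nonneg_pos mult_nonneg_nonneg pw_nonneg nn) (auto intro: less_imp_le)

lemma scaled_mult: "scaled s u v * scaled t v w \<le> scaled (s + t) u w"
proof -
  have "scaled s u v * scaled t v w = (pw A s (z u) (z v) * pw A t (z v) (z w)) * (potential u / potential w)"
    using potential_pos[of v] by (simp add: scaled_def)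
  also have "\<dots> \<le> pw A (s + t) (z u) (z w) * (potential u / potential w)"
    using potential_pos[of u] potential_pos[of w] by (intro mult_right_mono pw_add_ge nn) auto
  finally show ?thesis by (simp add: scaled_def)
qed

lemma scaled_cong:
  assumes "[u = u'] (mod int g)" "[v = v'] (mod int g)"
  shows "scaled t u v = scaled t u' v'"
  using potential_cong[OF assms(1)] potential_cong[OF assms(2)]
    z_eq[THEN iffD2, OF assms(1)] z_eq[THEN iffD2, OF assms(2)] by (simp add: scaled_def)

lemma scaled_rot:
  assumes "[u + int t = v] (mod int g)"
  shows "1 \<le> scaled t u v"
proof -
  have "1 \<le> scaled t u (u + int t)"
    using potential_le_pw[of u t] potential_pos[of "u + int t"]
    by (simp add: scaled_def mult.commute)
  then show ?thesis using scaled_cong[OF cong_refl assms] by simp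
qed

text \<open>Following the cycle from \<open>v\<close> back to \<open>u\<close> closes the walk
  without lowering its scaled weight.\<close>

lemma scaled_le_1: "scaled t u v \<le> 1"
proof -
  define s where "s = nat ((u - v) mod int g)"
  have "0 \<le> (u - v) mod int g" using g_pos by simp
  then have "[v + int s = u] (mod int g)" by (simp add: s_def cong_def mod_simps)
  then have "scaled t u v * 1 \<le> scaled t u v * scaled s v u"
    by (intro mult_left_mono scaled_rot scaled_nonneg)
  also have "\<dots> \<le> scaled (t + s) u u" by (rule scaled_mult)
  also have "\<dots> \<le> 1" using normalized potential_pos[of u] by (simp add: scaled_def normalized_def)
  finally show ?thesis by simp
qed

text \<open>By \<open>N\<close>, the nodes reached in multiples of \<open>d\<close> steps are values
  of \<open>z\<close> at multiples of \<open>d\<close>, so residues modulo \<open>q\<close> label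
  them all. Blocks of \<open>d\<close> steps with scaled weights then form a rotating frame, in
  which \<open>w + q\<close> blocks shrink to \<open>w\<close>.\<close>

lemma row_stable_hamiltonian:
  assumes g: "g = q * d" and q: "2 \<le> q"
    and N: "\<And>t i. 0 < pw A (t * d) (z 0) i \<Longrightarrow> i \<in> range (\<lambda>v. z (v * int d))"
  shows "row_stable A (z 0) g (d * ((q - 1)\<^sup>2 + 1))"
proof (rule row_stableI[OF nn loop_weight])
  define G where "G t u v = scaled (t * d) (u * int d) (v * int d)" for t u v
  have cong: "[u = v] (mod int q) \<Longrightarrow> [u * int d = v * int d] (mod int g)" for u v
    by (simp add: g cong_iff_dvd_diff flip: left_diff_distrib)
  interpret rotating_frame q G
  proof
    fix s t u v w u' v'
    show "G s u v * G t v w \<le> G (s + t) u w" by (simp add: G_def scaled_mult add_mult_distrib)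
    show "[u = u'] (mod int q) \<Longrightarrow> [v = v'] (mod int q) \<Longrightarrow> G t u v = G t u' v'"
      unfolding G_def by (intro scaled_cong cong)
    show "1 \<le> G t u v" if "[u + int t = v] (mod int q)"
      using cong[OF that] unfolding G_def by (intro scaled_rot) (simp add: algebra_simps)
  qed (auto simp: q G_def scaled_nonneg scaled_le_1)
  fix i
  define w where "w = (q - 1)\<^sup>2 + 1"
  have "pw A ((w + q) * d) (z 0) i \<le> pw A (w * d) (z 0) i"
  proof (cases "0 < pw A ((w + q) * d) (z 0) i")
    case True
    then obtain x where x: "x 0 = z 0" "x (w + q) = i"
      "pw A ((w + q) * d) (z 0) i = seq_weight A d x 0 (w + q)"
      using pw_seq_obtain[OF nn] by blast
    have "\<exists>v. x s = z (v * int d)" if "s \<le> w + q" for s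
    proof -
      have "0 < seq_weight A d x 0 s * seq_weight A d x s (w + q)"
        using True x(3) seq_weight_split[of 0 s "w + q" A d x] that by simp
      then have "0 < seq_weight A d x 0 s" using seq_weight_nonneg[OF nn]
        by (metis less_eq_real_def mult_eq_0_iff)
      also have "\<dots> \<le> pw A (s * d) (z 0) (x s)" using seq_weight_le_pw[OF nn, of 0 s d x] x by simp
      finally show ?thesis using N[of s "x s"] by auto
    qed
    then obtain y' where y': "\<And>s. s \<le> w + q \<Longrightarrow> x s = z (y' s * int d)" by metis
    \<comment> \<open>Labels are determined only modulo \<open>q\<close>; fixing the first as 0
      gives the start the potential \<open>potential 0\<close>.\<close>
    define y where "y = y'(0 := 0)"
    have y: "x s = z (y s * int d)" if "s \<le> w + q" for s using y'[OF that] x by (cases "s = 0") (auto simp: y_def)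
    \<comment> \<open>The potentials of intermediate nodes cancel.\<close>
    have "(\<Prod>s\<in>{0..<m}. G 1 (y s) (y (Suc s))) = seq_weight A d x 0 m * potential 0 / potential (y m * int d)"
      if "m \<le> w + q" for m
      using that
    proof (induction m)
      case 0
      show ?case using potential_pos[of 0] by (simp add: seq_weight_def y_def)
    next
      case (Suc m)
      have "G 1 (y m) (y (Suc m)) = pw A d (x m) (x (Suc m)) * potential (y m * int d) / potential (y (Suc m) * int d)"
        using y[of m] y[of "Suc m"] Suc.prems by (simp add: G_def scaled_def)
      then show ?case using Suc potential_pos[of "y m * int d"]
        by (simp add: seq_weight_def)
    qed
    then have "pw A ((w + q) * d) (z 0) i * (potential 0 / potential (y (w + q) * int d))
        = (\<Prod>s\<in>{0..<w + q}. G 1 (y s) (y (Suc s)))" using x by simp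
    also have "\<dots> \<le> G w (y 0) (y (w + q))"
      by (rule long_walk_shortened[OF w_def]) (simp add: cong_def)
    also have "\<dots> = pw A (w * d) (z 0) i * (potential 0 / potential (y (w + q) * int d))"
      using y[of "w + q"] x by (simp add: G_def scaled_def y_def)
    finally show ?thesis
      by (rule mult_right_le_imp_le) (simp add: potential_pos)
  next
    case False
    then show ?thesis using pw_nonneg[OF nn, of "w * d" "z 0" i] by linarith
  qed
  moreover have "d * w + g = (w + q) * d" by (simp add: g algebra_simps)
  ultimately have "pw A (d * w + g) (z 0) i \<le> pw A (d * w) (z 0) i" by (simp add: mult.commute)
  then show "pw A (d * ((q - 1)\<^sup>2 + 1) + g) (z 0) i \<le> pw A (d * ((q - 1)\<^sup>2 + 1)) (z 0) i"
    by (simp only: w_def)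
qed

end

section \<open>Cyclic classes\<close>

text \<open>Labels count only modulo \<open>d\<close>. Every labelling qualifies for
  \<open>d = 1\<close>, and negated labels serve the transposed matrix.\<close>

locale cyclic_classes = critical_cycle_seq A z g
  for A :: "real^'n^'n" and z :: "int \<Rightarrow> 'n" and g :: nat +
  fixes cls :: "'n \<Rightarrow> int" and d :: nat
  assumes d_pos: "0 < d"
    and cls_step: "0 < A $ i $ j \<Longrightarrow> [cls j = cls i + 1] (mod int d)"
begin

definition cyc_class :: "int \<Rightarrow> 'n set" where
  "cyc_class c = {i. [cls i = c] (mod int d)}"

lemma cyc_class_cong: "[c = c'] (mod int d) \<Longrightarrow> cyc_class c = cyc_class c'"
  by (auto simp: cyc_class_def intro: cong_trans cong_sym)

lemma cls_pw: "0 < pw A t i j \<Longrightarrow> [cls j = cls i + int t] (mod int d)"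
proof (induction t arbitrary: i)
  case 0
  then show ?case by (auto simp: pw_0 split: if_splits)
next
  case (Suc t)
  obtain l where l: "pw A (Suc t) i j = A $ i $ l * pw A t l j" by (rule pw_Suc_obtain)
  then have "0 < A $ i $ l" "0 < pw A t l j"
    using Suc.prems pw_nonneg[OF nn, of t l j] by (auto simp: zero_less_mult_iff)
  then have "[cls j = cls l + int t] (mod int d)" "[cls l + int t = cls i + 1 + int t] (mod int d)"
    using Suc.IH cls_step by (auto intro: cong_add)
  then show ?case by (metis (no_types, opaque_lifting) add.assoc cong_trans of_nat_Suc)
qed

lemma crit_walk_cls:
  assumes "\<And>u. (y u, y (Suc u)) \<in> crit A"
  shows "[cls (y (s + t)) = cls (y s) + int t] (mod int d)"
proof (induction t)
  case (Suc t)
  have "[cls (y (s + Suc t)) = cls (y (s + t)) + 1] (mod int d)"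
    using cls_step crit_pos[OF normalized assms] by simp
  also have "[cls (y (s + t)) + 1 = cls (y s) + int t + 1] (mod int d)"
    by (intro cong_add Suc cong_refl)
  finally show ?case by (simp add: ac_simps)
qed simp

lemma z_cls_nat: "[cls (z (u + int t)) = cls (z u) + int t] (mod int d)"
  using crit_walk_cls[of "\<lambda>t. z (u + int t)" 0 t] z_crit[of "u + int _"] by (simp add: ac_simps)

lemma d_dvd_g: "d dvd g"
proof -
  have "[cls (z 0) = cls (z 0) + int g] (mod int d)" using z_cls_nat[of 0 g] z_period(1)[of 0] by simp
  then show ?thesis by (simp add: cong_iff_dvd_diff)
qed

lemma z_cls: "[cls (z (u + v)) = cls (z u) + v] (mod int d)"
proof -
  have "0 \<le> v mod int g" using g_pos by simp
  then have "z (u + v) = z (u + int (nat (v mod int g)))" by (simp add: z_eq cong_def mod_simps)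
  also have "[cls \<dots> = cls (z u) + int (nat (v mod int g))] (mod int d)" by (rule z_cls_nat)
  also have "[cls (z u) + int (nat (v mod int g)) = cls (z u) + v] (mod int d)"
  proof (intro cong_add cong_refl)
    have "[v mod int g = v] (mod int g)" by (simp add: cong_def)
    then have "[v mod int g = v] (mod int d)" by (rule cong_dvd_modulus) (use d_dvd_g in simp)
    then show "[int (nat (v mod int g)) = v] (mod int d)" using \<open>0 \<le> v mod int g\<close> by simp
  qed
  finally show ?thesis .
qed

end

text \<open>\<open>h\<close> is the number of nodes of the cycle in each class.\<close>

locale cyclic_classes_period = cyclic_classes A z g cls d
  for A :: "real^'n^'n" and z g cls d +
  fixes h :: nat
  assumes g_eq: "g = h * d"
begin

lemma h_pos: "0 < h"
  using g_eq g_pos by (cases h) auto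

lemma cycle_in_class:
  assumes "[cls (z u) = c] (mod int d)"
  shows "(\<lambda>t. z (u + int t * int d)) ` {..<h} \<subseteq> cyc_class c"
    and "card ((\<lambda>t. z (u + int t * int d)) ` {..<h}) = h"
proof -
  have "[cls (z (u + int t * int d)) = c] (mod int d)" for t
  proof -
    have "[cls (z (u + int t * int d)) = cls (z u) + int t * int d] (mod int d)" by (rule z_cls)
    also have "[cls (z u) + int t * int d = c] (mod int d)" using assms by (simp add: cong_def)
    finally show ?thesis .
  qed
  then show "(\<lambda>t. z (u + int t * int d)) ` {..<h} \<subseteq> cyc_class c" by (auto simp: cyc_class_def)
  have "inj_on (\<lambda>t. z (u + int t * int d)) {..<h}"
  proof (rule inj_onI)
    fix s t assume st: "s \<in> {..<h}" "t \<in> {..<h}" "z (u + int s * int d) = z (u + int t * int d)"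
    then have "int h * int d dvd (int s - int t) * int d"
      by (simp add: z_eq cong_iff_dvd_diff g_eq left_diff_distrib)
    then have "[int s = int t] (mod int h)" using d_pos by (simp add: cong_iff_dvd_diff)
    then show "s = t" using st by (simp add: cong_def)
  qed
  then show "card ((\<lambda>t. z (u + int t * int d)) ` {..<h}) = h" by (simp add: card_image)
qed

lemma cycle_hits_class:
  obtains s where "s < d" "[cls (z (u + int s)) = c] (mod int d)"
proof
  let ?v = "(c - cls (z u)) mod int d"
  have v: "0 \<le> ?v" "?v < int d" using d_pos by auto
  then show "nat ?v < d" by linarith
  have "[cls (z (u + int (nat ?v))) = cls (z u) + int (nat ?v)] (mod int d)" by (rule z_cls)
  also have "[cls (z u) + int (nat ?v) = c] (mod int d)" using v by (simp add: cong_def mod_simps)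
  finally show "[cls (z (u + int (nat ?v))) = c] (mod int d)" .
qed

lemma card_class_ge: "h \<le> card (cyc_class c)"
proof -
  obtain s where "[cls (z (0 + int s)) = c] (mod int d)" by (rule cycle_hits_class)
  from cycle_in_class[OF this] show ?thesis by (metis card_mono finite)
qed

lemma card_off_cycle: "card (cyc_class c - range z) \<le> card (cyc_class c) - h"
proof -
  obtain s where "[cls (z (0 + int s)) = c] (mod int d)" by (rule cycle_hits_class)
  note Z = cycle_in_class[OF this]
  have "card (cyc_class c - range z) \<le> card (cyc_class c - (\<lambda>t. z (0 + int s + int t * int d)) ` {..<h})"
    by (intro card_mono) auto
  also have "\<dots> = card (cyc_class c) - h" using Z by (simp add: card_Diff_subset)
  finally show ?thesis .
qed

lemma sum_card_classes: "(\<Sum>c\<in>{0..<int d}. card (cyc_class c)) = CARD('n)"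
proof -
  have "UNIV = (\<Union>c\<in>{0..<int d}. cyc_class c)"
  proof (intro set_eqI iffI)
    fix i
    have "i \<in> cyc_class (cls i mod int d)" by (simp add: cyc_class_def cong_def)
    then show "i \<in> (\<Union>c\<in>{0..<int d}. cyc_class c)" using d_pos by (intro UN_I) auto
  qed simp
  then have "CARD('n) = card (\<Union>c\<in>{0..<int d}. cyc_class c)" by simp
  also have "\<dots> = (\<Sum>c\<in>{0..<int d}. card (cyc_class c))"
  proof (rule card_UN_disjoint)
    show "\<forall>c\<in>{0..<int d}. \<forall>c'\<in>{0..<int d}. c \<noteq> c' \<longrightarrow> cyc_class c \<inter> cyc_class c' = {}"
      by (auto simp: cyc_class_def cong_def)
  qed auto
  finally show ?thesis by simp
qed

lemma row_stable_on_cycle: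
  "row_stable A (z u) g (g * (card (cyc_class (cls (z u))) - 1))"
proof (rule row_stable_class[OF normalized loop_weight])
  fix m i assume "0 < pw A (m * g) (z u) i"
  then have "[cls i = cls (z u) + int (m * g)] (mod int d)" by (rule cls_pw)
  also have "[cls (z u) + int (m * g) = cls (z u)] (mod int d)" by (simp add: g_eq cong_iff_dvd_diff)
  finally show "i \<in> cyc_class (cls (z u))" by (simp add: cyc_class_def)
qed simp

text \<open>When the cycle fills the class of \<open>z u\<close>, every \<open>d\<close>-th of its
  nodes, counted from \<open>z u\<close>, runs through the whole class; this is the Hamiltonian
  situation after a shift of the index by \<open>u\<close>.\<close>

lemma row_stable_full_class:
  assumes full: "card (cyc_class (cls (z u))) = h" and "2 \<le> h"
  shows "row_stable A (z u) g (d * ((h - 1)\<^sup>2 + 1))"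
proof -
  interpret shifted: critical_cycle_seq A "\<lambda>v. z (v + u)" g
    by standard (use normalized g_pos z_crit[of "_ + u"] in
        \<open>auto simp: z_eq cong_iff_dvd_diff ac_simps\<close>)
  note Z = cycle_in_class[OF cong_refl[of "cls (z u)"]]
  have eq: "cyc_class (cls (z u)) = (\<lambda>t. z (u + int t * int d)) ` {..<h}"
    using card_subset_eq[OF _ Z(1)] Z(2) full by simp
  have "row_stable A (z (0 + u)) g (d * ((h - 1)\<^sup>2 + 1))"
  proof (rule shifted.row_stable_hamiltonian[OF g_eq \<open>2 \<le> h\<close>])
    fix t i assume "0 < pw A (t * d) (z (0 + u)) i"
    then have "[cls i = cls (z u) + int (t * d)] (mod int d)" using cls_pw[of "t * d" "z (0 + u)" i] by simp
    also have "[cls (z u) + int (t * d) = cls (z u)] (mod int d)" by (simp add: cong_def)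
    finally have "i \<in> cyc_class (cls (z u))" by (simp add: cyc_class_def)
    then obtain s where "i = z (int s * int d + u)" by (auto simp: eq add.commute)
    then show "i \<in> range (\<lambda>v. z (v * int d + u))" by blast
  qed
  then show ?thesis by simp
qed

end

text \<open>
  The walk \<open>y\<close> enters the cycle \<open>z\<close> at time \<open>p\<close> and then follows it. The parameter \<open>m\<close> stands for
  the number of nodes of a component of the critical graph that contains \<open>y\<close>.
\<close>

locale cyclic_classes_walk = cyclic_classes_period A z g cls d h
  for A :: "real^'n^'n" and z g cls d h +
  fixes y :: "nat \<Rightarrow> 'n" and p m q r :: nat
  assumes y_crit: "(y u, y (Suc u)) \<in> crit A"
    and y_cycle: "y (p + t) = z (int t)"
    and y_inj: "inj_on y {..<p}" and y_off: "u < p \<Longrightarrow> y u \<notin> range z"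
    and p_g_le: "p + g \<le> m" and m_le: "m \<le> CARD('n)"
    and n_eq: "CARD('n) = q * d + r" and r_less: "r < d"
begin

abbreviation good :: "int \<Rightarrow> bool" where
  "good c \<equiv> card (cyc_class c) = q"

lemma good_cong: "[c = c'] (mod int d) \<Longrightarrow> good c \<longleftrightarrow> good c'"
  by (simp add: cyc_class_cong)

lemma y_cls: "[cls (y (s + t)) = cls (y s) + int t] (mod int d)"
  by (rule crit_walk_cls) (rule y_crit)

lemma y_cls_back:
  assumes "d * t \<le> u"
  shows "[cls (y (u - d * t)) = cls (y u)] (mod int d)"
proof -
  have "[cls (y (u - d * t + d * t)) = cls (y (u - d * t)) + int (d * t)] (mod int d)" by (rule y_cls)
  then have "[cls (y u) = cls (y (u - d * t)) + int (d * t)] (mod int d)" using assms by simp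
  then show ?thesis by (simp add: cong_def)
qed

lemma row_stable_y:
  assumes "row_stable A (y L) g T"
  shows "row_stable A (y 0) g (T + L)"
  by (rule row_stable_path[OF normalized g_pos y_crit assms])

text \<open>A class with fewer than \<open>q\<close> nodes saves at least \<open>g\<close> steps,
  which pays for the fewer than \<open>d \<le> g\<close> steps along the cycle that lead to
  it.\<close>

lemma small_class_bound:
  assumes "card (cyc_class c) < q"
  obtains T where "row_stable A (y 0) g T" "h < q" "T + g \<le> g * (q - 1) + m"
proof -
  let ?m = "card (cyc_class c)"
  obtain s where s: "s < d" "[cls (z (0 + int s)) = c] (mod int d)" by (rule cycle_hits_class)
  have "row_stable A (y (p + s)) g (g * (?m - 1))"
    using row_stable_on_cycle[of "int s"] cyc_class_cong[OF s(2)] by (simp add: y_cycle)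
  from row_stable_y[OF this] have "row_stable A (y 0) g (g * (?m - 1) + (p + s))" .
  moreover have "h < q" using card_class_ge[of c] assms by simp
  moreover have "g * (?m - 1) + (p + s) + g \<le> g * (q - 1) + m"
  proof -
    have "0 < ?m" using card_class_ge[of c] h_pos by linarith
    then have "?m - 1 + 1 \<le> q - 1" using assms by linarith
    then have "g * (?m - 1 + 1) \<le> g * (q - 1)" by (rule mult_le_mono2)
    moreover have "d \<le> g" using g_eq h_pos by simp
    ultimately show ?thesis using s p_g_le by (simp add: algebra_simps)
  qed
  ultimately show ?thesis using that by blast
qed

text \<open>Before time \<open>p\<close> the walk repeats no node and avoids the cycle, so at the
  times \<open>u, u - d, ..., u - a * d\<close> it meets distinct nodes of one class off the cycle,
  of which there are at most \<open>q - h\<close>.\<close>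

lemma visits_le:
  assumes "good (cls (y u))" "u < p" "d * a \<le> u"
  shows "a + 1 \<le> q - h"
proof -
  let ?f = "\<lambda>t. y (u - d * t)"
  have le: "d * t \<le> u" if "t \<le> a" for t using that assms(3) mult_le_mono2[of t a d] by linarith
  have "inj_on ?f {..a}"
  proof (rule inj_onI)
    fix s t assume st: "s \<in> {..a}" "t \<in> {..a}" "y (u - d * s) = y (u - d * t)"
    then have "u - d * s = u - d * t" using inj_onD[OF y_inj] assms(2) by simp
    moreover have "d * s \<le> u" "d * t \<le> u" using le st by auto
    ultimately have "d * s = d * t" by linarith
    then show "s = t" using d_pos by simp
  qed
  moreover have "?f ` {..a} \<subseteq> cyc_class (cls (y u)) - range z"
  proof
    fix i assume "i \<in> ?f ` {..a}"
    then obtain t where t: "t \<le> a" "i = y (u - d * t)" by auto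
    then have "i \<notin> range z" using y_off[of "u - d * t"] assms(2) by simp
    then show "i \<in> cyc_class (cls (y u)) - range z"
      using y_cls_back[OF le[OF t(1)]] t(2) by (simp add: cyc_class_def)
  qed
  ultimately have "card {..a} \<le> card (cyc_class (cls (y u)) - range z)"
    by (intro card_inj_on_le[of ?f]) auto
  then show ?thesis using card_off_cycle[of "cls (y u)"] assms(1) by simp
qed

section \<open>The case that every class has at least \<open>q\<close> nodes\<close>

context
  assumes large: "\<And>c. q \<le> card (cyc_class c)"
begin

text \<open>Each class that is not good exceeds \<open>q\<close> by at least 1, and all excesses sum
  to \<open>r\<close>.\<close>

lemma card_bad: "card {c \<in> {0..<int d}. \<not> good c} \<le> r"
proof -
  let ?B = "{c \<in> {0..<int d}. \<not> good c}"
  have "card ?B + q * d = (\<Sum>c\<in>{0..<int d}. (if good c then 0 else 1) + q)"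
    by (simp add: sum.distrib sum.If_cases Int_def)
  also have "\<dots> \<le> (\<Sum>c\<in>{0..<int d}. card (cyc_class c))"
  proof (rule sum_mono)
    fix c show "(if good c then 0 else 1) + q \<le> card (cyc_class c)" using large[of c] by auto
  qed
  also have "\<dots> = q * d + r" by (simp add: sum_card_classes n_eq)
  finally show ?thesis by simp
qed

text \<open>Up to \<open>d\<close> consecutive nodes of the walk lie in distinct classes, so
  \<open>card_bad\<close> applies.\<close>

lemma bad_run:
  assumes "t \<le> d" "\<And>u. s \<le> u \<Longrightarrow> u < s + t \<Longrightarrow> \<not> good (cls (y u))"
  shows "t \<le> r"
proof -
  let ?f = "\<lambda>e. cls (y (s + e)) mod int d"
  have "inj_on ?f {..<t}"
  proof (rule inj_onI)
    fix e e' assume e: "e \<in> {..<t}" "e' \<in> {..<t}" "?f e = ?f e'"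
    then have "[cls (y s) + int e = cls (y s) + int e'] (mod int d)"
      using y_cls[of s e] y_cls[of s e'] by (simp add: cong_def)
    then have "[int e = int e'] (mod int d)" by (simp add: cong_add_lcancel)
    then show "e = e'" using e assms(1) by (simp add: cong_def)
  qed
  moreover have "?f ` {..<t} \<subseteq> {c \<in> {0..<int d}. \<not> good c}"
  proof
    fix c assume "c \<in> ?f ` {..<t}"
    then obtain e where e: "e < t" "c = ?f e" by auto
    have "good c \<longleftrightarrow> good (cls (y (s + e)))" by (rule good_cong) (simp add: e cong_def)
    then show "c \<in> {c \<in> {0..<int d}. \<not> good c}" using assms(2)[of "s + e"] e d_pos by simp
  qed
  moreover have "finite {c \<in> {0..<int d}. \<not> good c}" by (rule finite_subset[of _ "{0..<int d}"]) auto
  ultimately have "card {..<t} \<le> card {c \<in> {0..<int d}. \<not> good c}" by (rule card_inj_on_le)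
  then show ?thesis using card_bad by simp
qed

text \<open>\<open>L\<close> is the first good time from \<open>p\<close> on; the bad run from
  \<open>p\<close> to \<open>L\<close> gives the bound with \<open>m\<close>. For the bound with
  \<open>CARD('n)\<close>, earlier visits to the class of \<open>y L\<close> are counted at distance
  \<open>d\<close>.\<close>

lemma good_time_obtain:
  obtains L where "p \<le> L" "good (cls (y L))" "L + g \<le> CARD('n)" "L + g \<le> m + r"
proof -
  have ex: "\<exists>u. p \<le> u \<and> u < p + d \<and> good (cls (y u))"
    using bad_run[of d p] r_less by (meson le_refl not_less)
  define L where "L = (LEAST u. p \<le> u \<and> good (cls (y u)))"
  have L: "p \<le> L" "good (cls (y L))"
    using LeastI_ex[of "\<lambda>u. p \<le> u \<and> good (cls (y u))"] ex by (auto simp: L_def)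
  \<comment> \<open>By minimality of \<open>L\<close>, earlier good times precede the entrance into
    the cycle.\<close>
  have first: "u < p" if "u < L" "good (cls (y u))" for u
    using that not_less_Least[of u "\<lambda>u. p \<le> u \<and> good (cls (y u))"] by (auto simp: L_def)
  have "L - p \<le> r"
  proof (rule bad_run)
    obtain u where "p \<le> u" "u < p + d" "good (cls (y u))" using ex by blast
    then show "L - p \<le> d"
      using Least_le[of "\<lambda>u. p \<le> u \<and> good (cls (y u))" u] by (simp add: L_def)
    show "\<not> good (cls (y u))" if "p \<le> u" "u < p + (L - p)" for u
    proof -
      have "u < L" using that L(1) by arith
      then show ?thesis using first[of u] that by auto
    qed
  qed
  then have Lm: "L + g \<le> m + r" using L p_g_le by linarith
  define a b where "a = L div d" and "b = L mod d"
  have ab: "L = d * a + b" "b < d" using d_pos by (auto simp: a_def b_def)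
  have "h \<le> q" using card_class_ge[of "cls (y L)"] L by simp
  then obtain e where e: "q = h + e" using le_Suc_ex by blast
  \<comment> \<open>The visits at \<open>L - d, L - 2 * d, ...\<close> are to the same good class
    and precede \<open>p\<close>, so \<open>visits_le\<close> counts them.\<close>
  have "a \<le> q - h"
  proof (cases a)
    case (Suc a')
    then have dL: "d * 1 \<le> L" "d * a' \<le> L - d" using ab by auto
    from y_cls_back[OF dL(1)] have "good (cls (y (L - d)))" using L good_cong by simp
    moreover have "L - d < L" using dL d_pos by linarith
    ultimately show ?thesis using visits_le[of "L - d" a'] first[of "L - d"] dL(2) Suc by simp
  qed simp
  \<comment> \<open>If \<open>a = q - h\<close>, a good time among the last \<open>b\<close> before
    \<open>L\<close> would have \<open>a\<close> earlier visits to its class, one too many; so that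
    run is bad and \<open>b \<le> r\<close>. Otherwise a whole \<open>d\<close> is left over and
    \<open>b < d\<close> suffices.\<close>
  have "L + g \<le> CARD('n)"
  proof (cases "a = q - h")
    case True
    have "b \<le> r"
    proof (rule bad_run)
      fix u assume u: "L - b \<le> u" "u < L - b + b"
      show "\<not> good (cls (y u))"
      proof
        assume "good (cls (y u))"
        moreover have "u < L" using u ab by simp
        moreover have "d * a \<le> u" using u ab by simp
        ultimately have "a + 1 \<le> q - h" using first[of u] by (intro visits_le) auto
        then show False using True by simp
      qed
    qed (use ab in simp)
    then show ?thesis using True by (simp add: ab n_eq g_eq e algebra_simps)
  next
    case False
    then have "a + 1 \<le> e" using \<open>a \<le> q - h\<close> e by simp
    then have "d * (a + 1) \<le> d * e" by (rule mult_le_mono2)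
    then show ?thesis using ab by (simp add: n_eq g_eq e algebra_simps)
  qed
  then show ?thesis using that L Lm by blast
qed

lemma large_classes_bounds:
  obtains T where "row_stable A (y 0) g T" "0 < q" "T + g \<le> g * (q - 1) + CARD('n)"
      "T + g \<le> g * (q - 1) + m + r" "h = q \<Longrightarrow> row_stable A (y 0) g (d * Wi q + r)"
proof -
  obtain L where L: "p \<le> L" "good (cls (y L))" "L + g \<le> CARD('n)" "L + g \<le> m + r"
    by (rule good_time_obtain)
  have yL: "y L = z (int (L - p))" using y_cycle[of "L - p"] L(1) by simp
  have st: "row_stable A (y L) g (g * (q - 1))"
    using row_stable_on_cycle[of "int (L - p)"] L(2) by (simp add: yL)
  have q: "0 < q" using card_class_ge[of 0] card_class_ge[of "cls (y L)"] L(2) h_pos by linarith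
  have "row_stable A (y 0) g (d * Wi q + r)" if "h = q"
  proof -
    have "row_stable A (y L) g (d * Wi q)"
    \<comment> \<open>For \<open>q = 1\<close> the general bound \<open>g * (q - 1)\<close> is
      already 0, while \<open>row_stable_full_class\<close> asks for
      \<open>2 \<le> h\<close>.\<close>
    proof (cases "q = 1")
      case True
      then show ?thesis using st by (simp add: Wi_def)
    next
      case False
      then have "2 \<le> h" using q that by simp
      with row_stable_full_class[of "int (L - p)"] L(2) that show ?thesis
        by (simp add: yL Wi_def)
    qed
    from row_stable_y[OF this] have "row_stable A (y 0) g (d * Wi q + L)" .
    \<comment> \<open>Here \<open>g = q * d\<close>, so \<open>L + g \<le> CARD('n)\<close> leaves
      only \<open>r\<close> steps before the good time.\<close>
    moreover have "L \<le> r" using L(3) that by (simp add: n_eq g_eq)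
    ultimately show ?thesis by (auto simp: row_stable_def)
  qed
  then show ?thesis using that[OF row_stable_y[OF st] q] L by simp
qed

end

text \<open>From \<open>h \<le> q - 1\<close> follows
  \<open>g * (q - 2) + q * d \<le> d * ((q - 1) * (q - 2) + q)\<close>, and the last factor is
  \<open>(q - 1)^2 + 1\<close>. Only \<open>h = q\<close> calls for the Hamiltonian case.\<close>

lemma Schwarz_arith:
  assumes "h < q" "T + g \<le> g * (q - 1) + CARD('n)"
  shows "T \<le> d * Wi q + r"
proof -
  have "2 \<le> q" using assms(1) h_pos by linarith
  then obtain e where e: "q = e + 2" using le_Suc_ex by (metis add.commute)
  have "h * (d * e) \<le> (e + 1) * (d * e)" using assms(1) e by (intro mult_le_mono1) simp
  then show ?thesis using assms(2) by (simp add: e g_eq n_eq Wi_def power2_eq_square algebra_simps)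
qed

lemma Schwarz_bound: "row_stable A (y 0) g (d * Wi q + r)"
proof (cases "\<exists>c. card (cyc_class c) < q")
  case True
  then obtain T where T: "row_stable A (y 0) g T" "h < q" "T + g \<le> g * (q - 1) + m"
    using small_class_bound by blast
  then have "T \<le> d * Wi q + r" using m_le by (intro Schwarz_arith) auto
  then show ?thesis using T(1) by (auto simp: row_stable_def)
next
  case False
  then have large: "\<And>c. q \<le> card (cyc_class c)" by (simp add: not_less)
  obtain T where T: "row_stable A (y 0) g T" "T + g \<le> g * (q - 1) + CARD('n)"
      "h = q \<Longrightarrow> row_stable A (y 0) g (d * Wi q + r)"
    using large_classes_bounds[OF large] by metis
  show ?thesis
  proof (cases "h = q")
    case False
    have "h * d < (q + 1) * d" using p_g_le m_le n_eq r_less g_eq by simp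
    then have "h < q + 1" by (simp only: mult_less_cancel2)
    then have "h < q" using False by simp
    then have "T \<le> d * Wi q + r" using T(2) by (rule Schwarz_arith)
    then show ?thesis using T(1) by (auto simp: row_stable_def)
  qed (use T in auto)
qed

lemma Kim_bound:
  obtains T where "row_stable A (y 0) g T"
    "int T \<le> (int q - 2) * int g + min (int CARD('n)) (int m + int r)"
proof -
  obtain T where T: "row_stable A (y 0) g T" "0 < q" "T + g \<le> g * (q - 1) + CARD('n)"
      "T + g \<le> g * (q - 1) + m + r"
  proof (cases "\<exists>c. card (cyc_class c) < q")
    case True
    then obtain T where "row_stable A (y 0) g T" "h < q" "T + g \<le> g * (q - 1) + m"
      using small_class_bound by blast
    then show ?thesis using that[of T] m_le by auto
  next
    case False
    then have "\<And>c. q \<le> card (cyc_class c)" by (simp add: not_less)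
    then show ?thesis using large_classes_bounds that by metis
  qed
  \<comment> \<open>This makes the truncated \<open>q - 1\<close> exact; moving \<open>g\<close>
    across then gives the integer factor \<open>q - 2\<close>, negative for
    \<open>q = 1\<close>.\<close>
  obtain e where e: "q = Suc e" using T(2) gr0_implies_Suc by blast
  have "int T + int g \<le> int g * int e + int CARD('n)" "int T + int g \<le> int g * int e + int m + int r"
    using T(3,4) unfolding e by (simp_all flip: of_nat_add of_nat_mult)
  then have "int T \<le> (int q - 2) * int g + min (int CARD('n)) (int m + int r)"
    by (simp add: e algebra_simps)
  then show ?thesis using that T(1) by blast
qed

end

section \<open>Components of the critical graph\<close>

text \<open>\<open>R\<close> stands for the arcs of the component or their reversal and
  \<open>V\<close> for its nodes, so that one statement serves rows and columns.\<close>

lemma critical_row_bounds: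
  fixes A :: "real^'n^'n" and z :: "int \<Rightarrow> 'n"
  assumes A: "normalized A" and R: "R \<subseteq> crit A" and V: "R \<subseteq> V \<times> V" "card V = m"
    and g: "0 < g" and z_eq: "\<And>u v. z u = z v \<longleftrightarrow> [u = v] (mod int g)"
    and z_R: "\<And>u. (z u, z (u + 1)) \<in> R" and k: "(k, z 0) \<in> R\<^sup>*"
    and d: "0 < d" and cls: "\<forall>i j. 0 < A $ i $ j \<longrightarrow> [cls j = cls i + 1] (mod int d)"
  shows "row_stable A k g (d * Wi (CARD('n) div d) + CARD('n) mod d)"
    and "\<exists>T. row_stable A k g T \<and> int T \<le>
      (int (CARD('n) div d) - 2) * int g + min (int CARD('n)) (int m + int (CARD('n) mod d))"
proof -
  \<comment> \<open>Any node of the cycle may be the endpoint; minimality makes the path simple and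
    keeps it off the cycle until its end.\<close>
  define P where "P p \<longleftrightarrow> (\<exists>v. (k, z v) \<in> R ^^ p)" for p
  define p where "p = (LEAST p. P p)"
  have ex: "\<exists>p. P p" using rtrancl_imp_relpow[OF k] by (auto simp: P_def)
  then have "P p" unfolding p_def by (rule LeastI_ex)
  then obtain v0 f where f: "f 0 = k" "f p = z v0" "\<And>u. u < p \<Longrightarrow> (f u, f (Suc u)) \<in> R"
    unfolding P_def relpow_fun_conv by blast
  have least: "p \<le> u" if "P u" for u unfolding p_def using that by (rule Least_le)
  have path: "(f u, f v) \<in> R ^^ (v - u)" if "u \<le> v" "v \<le> p" for u v
    unfolding relpow_fun_conv using that f(3)
    by (intro exI[of _ "\<lambda>e. f (u + e)"]) auto
  define y where "y u = (if u < p then f u else z (v0 + int (u - p)))" for u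
  \<comment> \<open>The index is shifted so that the cycle starts where the path enters it.\<close>
  interpret C: critical_cycle_seq A "\<lambda>v. z (v + v0)" g
    by standard (use A R g z_R[of "_ + v0"] in \<open>auto simp: z_eq cong_iff_dvd_diff ac_simps\<close>)
  interpret C: cyclic_classes A "\<lambda>v. z (v + v0)" g cls d
    by standard (use d cls in auto)
  obtain h where h: "g = h * d" using C.d_dvd_g by (auto simp: dvd_def mult.commute)
  have inj: "inj_on f {..<p}"
  proof (rule linorder_inj_onI)
    fix u v assume uv: "u < v" "u \<in> {..<p}" "v \<in> {..<p}"
    show "f u \<noteq> f v"
    proof
      assume "f u = f v"
      then have "(k, z v0) \<in> R ^^ (u + (p - v))"
        using path[of 0 u] path[of v p] uv f unfolding relpow_add by auto
      then have "p \<le> u + (p - v)" by (intro least) (auto simp: P_def)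
      then show False using uv by auto
    qed
  qed auto
  have off: "f u \<notin> range z" if "u < p" for u
  proof
    assume "f u \<in> range z"
    then have "P u" using path[of 0 u] that f(1) by (auto simp: P_def)
    then show False using least that by force
  qed
  have "p + g \<le> m"
  proof -
    have z_inj: "inj_on z {0..<int g}"
      by (rule inj_onI) (simp add: z_eq cong_def)
    have "f ` {..<p} \<inter> z ` {0..<int g} = {}" using off by auto
    then have "card (f ` {..<p} \<union> z ` {0..<int g}) = p + g"
      using inj z_inj by (simp add: card_Un_disjoint card_image)
    moreover have "f ` {..<p} \<union> z ` {0..<int g} \<subseteq> V" using f(3) z_R V(1) by auto
    ultimately show ?thesis using card_mono[OF finite, of "f ` {..<p} \<union> z ` {0..<int g}" V] V(2) by simp
  qed
  interpret C: cyclic_classes_walk A "\<lambda>v. z (v + v0)" g cls d h y p m "CARD('n) div d" "CARD('n) mod d"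
  proof
    show "(y u, y (Suc u)) \<in> crit A" for u
    proof (cases "u < p")
      case True
      then have "(f u, f (Suc u)) \<in> crit A" using f(3) R by blast
      then show ?thesis using True f(2) by (cases "Suc u = p") (auto simp: y_def)
    next
      case False
      then show ?thesis using z_R[of "v0 + int (u - p)"] R by (auto simp: y_def Suc_diff_le ac_simps)
    qed
    show "inj_on y {..<p}" using inj by (simp add: inj_on_def y_def)
    show "m \<le> CARD('n)" using V(2) by (auto intro: card_mono)
    show "y u \<notin> range (\<lambda>v. z (v + v0))" if "u < p" for u using off[OF that] that by (auto simp: y_def)
  qed (use h d \<open>p + g \<le> m\<close> in \<open>auto simp: y_def add.commute\<close>)
  have y0: "y 0 = k" using f(1,2) by (auto simp: y_def)
  show "row_stable A k g (d * Wi (CARD('n) div d) + CARD('n) mod d)"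
    using C.Schwarz_bound by (simp add: y0)
  show "\<exists>T. row_stable A k g T \<and> int T \<le>
      (int (CARD('n) div d) - 2) * int g + min (int CARD('n)) (int m + int (CARD('n) mod d))"
    using C.Kim_bound unfolding y0 by blast
qed

section \<open>Cycles as arc lists and as node sequences\<close>

lemma cas_nth:
  assumes "pre_digraph.cas G u p v" "p \<noteq> []"
  shows "tail G (p ! 0) = u \<and> head G (last p) = v \<and>
    (\<forall>i. Suc i < length p \<longrightarrow> tail G (p ! Suc i) = head G (p ! i))"
  using assms
proof (induction p arbitrary: u)
  case (Cons e p)
  note [simp] = pre_digraph.cas.simps
  show ?case
  proof (cases "p = []")
    case False
    from Cons.IH[OF _ this, of "head G e"] Cons.prems show ?thesis
      using False by (auto simp: nth_Cons split: nat.split)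
  qed (use Cons.prems in auto)
qed simp

lemma cycle_seq_obtain:
  fixes G :: "('n, 'n \<times> 'n) pre_digraph"
  assumes cyc: "pre_digraph.cycle G p" and G: "tail G = fst" "head G = snd"
  obtains z :: "int \<Rightarrow> 'n" where "0 < length p" "set p \<subseteq> arcs G"
    "\<And>u v. z u = z v \<longleftrightarrow> [u = v] (mod int (length p))"
    "\<And>i. i < length p \<Longrightarrow> p ! i = (z (int i), z (int i + 1))"
    "\<And>u. (z u, z (u + 1)) \<in> set p"
proof -
  define g where "g = length p"
  obtain w where w: "pre_digraph.awalk G w p w" "distinct (tl (pre_digraph.awalk_verts G w p))" "p \<noteq> []"
    using cyc unfolding pre_digraph.cycle_def by blast
  have cas: "pre_digraph.cas G w p w" and sub: "set p \<subseteq> arcs G"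
    using w(1) by (auto simp: pre_digraph.awalk_def)
  have g0: "0 < g" using w(3) by (simp add: g_def)
  have dist: "distinct (map snd p)"
    using w(2,3) by (simp add: pre_digraph.awalk_verts_conv'[OF cas] G)
  note nth = cas_nth[OF cas w(3), unfolded G]
  define z where "z u = fst (p ! nat (u mod int g))" for u
  have z_nat: "z (int i) = fst (p ! i)" if "i < g" for i using that by (simp add: z_def)
  have z_mod: "z (u mod int g) = z u" for u by (simp add: z_def)
  have succ: "snd (p ! i) = z (int i + 1)" if "i < g" for i
  proof (cases "Suc i = g")
    case True
    then have "z (int i + 1) = z 0" by (simp add: z_def add.commute flip: True)
    also have "\<dots> = w" using nth z_nat[of 0] g0 by simp
    also have "w = snd (p ! i)"
    proof -
      have "length p - 1 = i" using True by (simp add: g_def)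
      then show ?thesis using nth w(3) by (metis last_conv_nth)
    qed
    finally show ?thesis by simp
  next
    case False
    then have "z (int (Suc i)) = fst (p ! Suc i)" using that by (intro z_nat) simp
    then show ?thesis using nth False that by (simp add: g_def add.commute)
  qed
  \<comment> \<open>Shifted by 1, since distinctness is known for the heads of the arcs.\<close>
  have z_inj: "i = j" if "i < g" "j < g" "z (int i + 1) = z (int j + 1)" for i j
    using that dist succ[of i] succ[of j] by (metis g_def length_map nth_eq_iff_index_eq nth_map)
  have z_eq: "z u = z v \<longleftrightarrow> [u = v] (mod int g)" for u v
  proof
    assume uv: "z u = z v"
    define i j where "i = nat ((u - 1) mod int g)" and "j = nat ((v - 1) mod int g)"
    have ij: "int i = (u - 1) mod int g" "int j = (v - 1) mod int g" "i < g" "j < g"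
      using g0 by (auto simp: i_def j_def nat_less_iff)
    have "z (int i + 1) = z u" "z (int j + 1) = z v"
      using z_mod[of "int i + 1"] z_mod[of "int j + 1"] z_mod[of u] z_mod[of v] by (simp_all add: ij mod_simps)
    then have "i = j" using uv ij by (intro z_inj) auto
    then have "[u - 1 = v - 1] (mod int g)" using ij by (simp add: cong_def)
    then show "[u = v] (mod int g)" by (simp add: cong_iff_dvd_diff)
  next
    assume "[u = v] (mod int g)"
    then show "z u = z v" by (simp add: z_def cong_def)
  qed
  have arc: "p ! i = (z (int i), z (int i + 1))" if "i < g" for i
    using z_nat[OF that] succ[OF that] by (simp add: prod_eq_iff)
  have "(z u, z (u + 1)) \<in> set p" for u
  proof -
    define i where "i = nat (u mod int g)"
    have i: "int i = u mod int g" "i < g" using g0 by (auto simp: i_def nat_less_iff)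
    have "z (int i) = z u" "z (int i + 1) = z (u + 1)" by (simp_all add: z_eq i cong_def mod_simps)
    then have "(z u, z (u + 1)) = p ! i" using arc[OF i(2)] by simp
    then show ?thesis using i(2) by (simp add: g_def)
  qed
  then show ?thesis using that[of z] g0 sub z_eq arc by (simp add: g_def)
qed

lemma cas_seq:
  assumes "tail G = fst" "head G = snd" "s \<le> t"
  shows "pre_digraph.cas G (x s) (map (\<lambda>u. (x u, x (Suc u))) [s..<t]) (x t)"
  using assms(3)
proof (induction "t - s" arbitrary: s)
  case 0
  then show ?case by (simp add: pre_digraph.cas.simps)
next
  case (Suc e)
  then have "[s..<t] = s # [Suc s..<t]" by (simp add: upt_conv_Cons)
  then show ?case using Suc.hyps(1)[of "Suc s"] Suc.hyps(2) Suc.prems assms(1,2)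
    by (simp add: pre_digraph.cas.simps)
qed

lemma seq_cycle:
  fixes G :: "('n, 'n \<times> 'n) pre_digraph"
  assumes G: "tail G = fst" "head G = snd" "wf_digraph G"
    and x: "0 < t" "x t = x 0" "inj_on x {..<t}" "\<And>u. u < t \<Longrightarrow> (x u, x (Suc u)) \<in> arcs G"
  shows "pre_digraph.cycle G (map (\<lambda>u. (x u, x (Suc u))) [0..<t])"
proof -
  let ?p = "map (\<lambda>u. (x u, x (Suc u))) [0..<t]"
  have cas: "pre_digraph.cas G (x 0) ?p (x 0)" using cas_seq[OF G(1,2), of 0 t x] x(2) by simp
  have "x 0 \<in> verts G" using wf_digraph.tail_in_verts[OF G(3) x(4)[OF x(1)]] G by simp
  then have "pre_digraph.awalk G (x 0) ?p (x 0)"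
    using cas x(4) by (auto simp: pre_digraph.awalk_def)
  moreover have "distinct (tl (pre_digraph.awalk_verts G (x 0) ?p))"
  proof -
    have "inj_on (x \<circ> Suc) {0..<t}"
    proof (rule inj_onI)
      fix a b assume ab: "a \<in> {0..<t}" "b \<in> {0..<t}" "(x \<circ> Suc) a = (x \<circ> Suc) b"
      have "x (Suc c) = x (if Suc c = t then 0 else Suc c)" if "c < t" for c using x(2) by auto
      then have "x (if Suc a = t then 0 else Suc a) = x (if Suc b = t then 0 else Suc b)" using ab by auto
      then have "(if Suc a = t then 0 else Suc a) = (if Suc b = t then 0 else Suc b)"
        using ab by (intro inj_onD[OF x(3)]) auto
      then show "a = b" by (auto split: if_splits)
    qed
    then have "distinct (map (x \<circ> Suc) [0..<t])" by (simp add: distinct_map)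
    then show ?thesis using x(1) by (simp add: pre_digraph.awalk_verts_conv'[OF cas] G comp_def)
  qed
  ultimately show ?thesis unfolding pre_digraph.cycle_def using x(1) by (intro exI[of _ "x 0"]) auto
qed

text \<open>A closed walk that repeats a node splits into two shorter closed walks. Powers of
  \<open>l\<close> multiply and multiples of \<open>D\<close> add up accordingly, so checking cycles
  without repeated nodes suffices.\<close>

lemma closed_walk_induct:
  fixes A :: "real^'n^'n"
  assumes nn: "nonneg_matrix A" and l: "0 \<le> l"
    and cyc: "\<And>x t. 0 < t \<Longrightarrow> x t = x 0 \<Longrightarrow> inj_on x {..<t} \<Longrightarrow> (\<And>u. u < t \<Longrightarrow> 0 < A $ x u $ x (Suc u))
      \<Longrightarrow> (\<Prod>u\<in>{0..<t}. A $ x u $ x (Suc u)) \<le> l ^ t \<and> D dvd t"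
    and pos: "0 < pw A t i i"
  shows "pw A t i i \<le> l ^ t \<and> D dvd t"
  using pos
proof (induction t arbitrary: i rule: less_induct)
  case (less t)
  show ?case
  proof (cases "t = 0")
    case True
    then show ?thesis by (simp add: pw_0)
  next
    case False
    obtain x where x: "x 0 = i" "x t = i" "pw A t i i = seq_weight A 1 x 0 t"
      using pw_seq_obtain[OF nn, of t 1 i i] less.prems by auto
    let ?w = "seq_weight A 1 x"
    have stepp: "0 < A $ x u $ x (Suc u)" if "u < t" for u
      using seq_weight_pos_step[OF nn, of 1 x t u] less.prems x that by (simp add: pw_1[OF nn])
    show ?thesis
    proof (cases "inj_on x {..<t}")
      case True
      have "pw A t i i = (\<Prod>u\<in>{0..<t}. A $ x u $ x (Suc u))" by (simp only: x(3) seq_weight_1[OF nn])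
      then show ?thesis using cyc[of t x] stepp \<open>t \<noteq> 0\<close> True x(1,2) by simp
    next
      case False
      then obtain u v where uv: "u < v" "v < t" "x u = x v"
        unfolding inj_on_def by (metis lessThan_iff linorder_neqE_nat)
      have split: "pw A t i i = ?w 0 u * ?w u v * ?w v t"
        using x(3) uv seq_weight_split[of 0 u t A 1 x] seq_weight_split[of u v t A 1 x] by simp
      have wn: "0 \<le> ?w a b" for a b by (rule seq_weight_nonneg[OF nn])
      have wp: "0 < ?w 0 u" "0 < ?w u v" "0 < ?w v t"
        using less.prems wn[of 0 u] wn[of u v] wn[of v t] unfolding split
        by (auto simp: zero_less_mult_iff)
      have inner: "?w u v \<le> pw A (v - u) (x u) (x u)"
        using seq_weight_le_pw[OF nn, of u v 1 x] uv by simp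
      have "?w 0 u * ?w v t \<le> pw A u i (x u) * pw A (t - v) (x u) i"
        using seq_weight_le_pw[OF nn, of 0 u 1 x] seq_weight_le_pw[OF nn, of v t 1 x] uv x wn
        by (intro mult_mono pw_nonneg nn) auto
      also have "\<dots> \<le> pw A (u + (t - v)) i i" by (intro pw_add_ge nn)
      finally have outer: "?w 0 u * ?w v t \<le> pw A (u + (t - v)) i i" .
      have IH1: "pw A (v - u) (x u) (x u) \<le> l ^ (v - u) \<and> D dvd v - u"
        using inner wp uv by (intro less.IH) auto
      have "0 < ?w 0 u * ?w v t" using wp by simp
      then have IH2: "pw A (u + (t - v)) i i \<le> l ^ (u + (t - v)) \<and> D dvd u + (t - v)"
        using outer uv by (intro less.IH) auto
      have t: "(v - u) + (u + (t - v)) = t" using uv by simp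
      have "pw A t i i = ?w u v * (?w 0 u * ?w v t)" by (simp add: split)
      also have "\<dots> \<le> l ^ (v - u) * l ^ (u + (t - v))"
        using inner outer IH1 IH2 wn l by (intro mult_mono) (auto intro: order_trans)
      also have "\<dots> = l ^ t" using t by (simp flip: power_add)
      finally have "pw A t i i \<le> l ^ t" .
      moreover have "D dvd (v - u) + (u + (t - v))" 
        by (rule dvd_add[OF conjunct2[OF IH1] conjunct2[OF IH2]])
      ultimately show ?thesis using t by simp
    qed
  qed
qed

section \<open>Maximal cycle mean and critical cycles\<close>

lemma mat_digraph_simps [simp]:
  "verts (mat_digraph A) = UNIV" "arcs (mat_digraph A) = {(i, j). A $ i $ j > 0}"
  "tail (mat_digraph A) = fst" "head (mat_digraph A) = snd"
  by (simp_all add: mat_digraph_def)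

lemma critical_digraph_simps [simp]:
  "tail (critical_digraph A) = fst" "head (critical_digraph A) = snd"
  by (simp_all add: critical_digraph_def)

lemma wf_mat_digraph: "wf_digraph (mat_digraph A)"
  by unfold_locales auto

lemma wf_critical_digraph: "wf_digraph (critical_digraph A)"
  by unfold_locales (auto simp: critical_digraph_def)

lemma finite_cycles: "finite {p. pre_digraph.cycle (mat_digraph A) p}"
proof (rule finite_subset)
  show "{p. pre_digraph.cycle (mat_digraph A) p} \<subseteq> {p. set p \<subseteq> UNIV \<and> distinct p}"
    using wf_digraph.cycle_conv[OF wf_mat_digraph] by blast
qed (rule finite_subset_distinct[OF finite])

lemma cycle_weight_pos:
  assumes "pre_digraph.cycle (mat_digraph A) p"
  shows "0 < walk_weight A p"
proof -
  have "\<forall>e\<in>set p. 0 < A $ fst e $ snd e"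
    using assms unfolding pre_digraph.cycle_def pre_digraph.awalk_def by auto
  then show ?thesis unfolding walk_weight_def by (induction p) auto
qed

lemma cycle_mean_power:
  assumes "pre_digraph.cycle (mat_digraph A) p"
  shows "cycle_mean A p ^ length p = walk_weight A p"
proof -
  have w: "0 < walk_weight A p" by (rule cycle_weight_pos[OF assms])
  have p: "p \<noteq> []" using assms by (auto simp: pre_digraph.cycle_def)
  have "cycle_mean A p ^ length p = cycle_mean A p powr real (length p)"
    using w by (simp add: cycle_mean_def powr_realpow)
  also have "\<dots> = walk_weight A p" using w p by (simp add: cycle_mean_def powr_powr)
  finally show ?thesis .
qed

lemma cycle_mean_le_max:
  assumes "pre_digraph.cycle (mat_digraph A) p"
  shows "cycle_mean A p \<le> max_cycle_mean A"
proof -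
  have "{cycle_mean A p | p. pre_digraph.cycle (mat_digraph A) p}
      = cycle_mean A ` {p. pre_digraph.cycle (mat_digraph A) p}" by auto
  then have "finite {cycle_mean A p | p. pre_digraph.cycle (mat_digraph A) p}"
    by (simp only:) (rule finite_imageI[OF finite_cycles])
  then show ?thesis using assms unfolding max_cycle_mean_def by (auto intro!: Max_ge)
qed

lemma cycle_weight_le:
  assumes "pre_digraph.cycle (mat_digraph A) p"
  shows "walk_weight A p \<le> max_cycle_mean A ^ length p"
proof -
  have "0 \<le> cycle_mean A p" by (simp add: cycle_mean_def)
  then show ?thesis using power_mono[OF cycle_mean_le_max[OF assms], of "length p"]
    by (simp add: cycle_mean_power[OF assms])
qed

lemma max_cycle_mean_nonneg: "0 \<le> max_cycle_mean A"
proof (cases "\<exists>p. pre_digraph.cycle (mat_digraph A) p")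
  case True
  then obtain p where "pre_digraph.cycle (mat_digraph A) p" by blast
  from cycle_mean_le_max[OF this] show ?thesis by (rule order_trans[rotated]) (simp add: cycle_mean_def)
qed (simp add: max_cycle_mean_def)

lemma critical_cycle_weight:
  assumes "critical_cycle A p"
  shows "walk_weight A p = max_cycle_mean A ^ length p" "0 < max_cycle_mean A"
proof -
  have c: "pre_digraph.cycle (mat_digraph A) p" using assms by (simp add: critical_cycle_def)
  show w: "walk_weight A p = max_cycle_mean A ^ length p"
    using assms cycle_mean_power[OF c] by (simp add: critical_cycle_def)
  have "p \<noteq> []" using c by (auto simp: pre_digraph.cycle_def)
  then have "max_cycle_mean A \<noteq> 0" using w cycle_weight_pos[OF c] by (auto simp: power_0_left)
  then show "0 < max_cycle_mean A" using max_cycle_mean_nonneg[of A] by simp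
qed

lemma closed_walk_bounds:
  assumes nn: "nonneg_matrix A" and pos: "0 < pw A t i i"
  shows "pw A t i i \<le> max_cycle_mean A ^ t" "cyclicity (mat_digraph A) dvd t"
proof -
  have "pw A t i i \<le> max_cycle_mean A ^ t \<and> cyclicity (mat_digraph A) dvd t"
  proof (rule closed_walk_induct[OF nn max_cycle_mean_nonneg _ pos])
    fix x :: "nat \<Rightarrow> 'a" and t
    assume x: "0 < t" "x t = x 0" "inj_on x {..<t}" "\<And>u. u < t \<Longrightarrow> 0 < A $ x u $ x (Suc u)"
    let ?p = "map (\<lambda>u. (x u, x (Suc u))) [0..<t]"
    have cyc: "pre_digraph.cycle (mat_digraph A) ?p"
      using x by (intro seq_cycle wf_mat_digraph) auto
    have "walk_weight A ?p = (\<Prod>u\<in>{0..<t}. A $ x u $ x (Suc u))"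
      unfolding walk_weight_def prod.list_conv_set_nth by simp
    moreover have "cyclicity (mat_digraph A) dvd length ?p"
      unfolding cyclicity_def using cyc by (intro Gcd_dvd) blast
    ultimately show "(\<Prod>u\<in>{0..<t}. A $ x u $ x (Suc u)) \<le> max_cycle_mean A ^ t
        \<and> cyclicity (mat_digraph A) dvd t"
      using cycle_weight_le[OF cyc] by simp
  qed
  then show "pw A t i i \<le> max_cycle_mean A ^ t" "cyclicity (mat_digraph A) dvd t" by auto
qed

text \<open>The remainder of the cycle leads from \<open>j\<close> back to \<open>i\<close>. After
  division by the cycle mean this places critical arcs in \<open>crit\<close>.\<close>

lemma critical_arc_return:
  assumes nn: "nonneg_matrix A" and c: "critical_cycle A p" and e: "(i, j) \<in> set p"
  shows "\<exists>t. max_cycle_mean A ^ Suc t \<le> A $ i $ j * pw A t j i"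
proof -
  have "pre_digraph.cycle (mat_digraph A) p" using c by (simp add: critical_cycle_def)
  then obtain z :: "int \<Rightarrow> 'a" where z: "0 < length p"
    "\<And>u v. z u = z v \<longleftrightarrow> [u = v] (mod int (length p))"
    "\<And>i. i < length p \<Longrightarrow> p ! i = (z (int i), z (int i + 1))"
    by (rule cycle_seq_obtain) (auto simp: mat_digraph_def)
  define x where "x u = z (int u)" for u :: nat
  let ?g = "length p" and ?w = "seq_weight A 1 x"
  have px: "p ! u = (x u, x (Suc u))" if "u < ?g" for u using z(3)[OF that] by (simp add: x_def add.commute)
  have xg: "x ?g = x 0" by (simp add: x_def z(2) cong_def)
  obtain u where u: "u < ?g" "p ! u = (i, j)" using e by (auto simp: in_set_conv_nth)
  then have ij: "i = x u" "j = x (Suc u)" using px by auto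
  have "walk_weight A p = (\<Prod>u\<in>{0..<?g}. A $ x u $ x (Suc u))"
    unfolding walk_weight_def prod.list_conv_set_nth using px by (auto intro!: prod.cong)
  then have "max_cycle_mean A ^ ?g = ?w 0 ?g"
    using critical_cycle_weight(1)[OF c] by (simp only: seq_weight_1[OF nn])
  also have "\<dots> = ?w 0 u * ?w u (Suc u) * ?w (Suc u) ?g"
    using u(1) seq_weight_split[of 0 u ?g A 1 x] seq_weight_split[of u "Suc u" ?g A 1 x] by simp
  also have "\<dots> = A $ i $ j * (?w (Suc u) ?g * ?w 0 u)"
    by (simp add: ij seq_weight_def pw_1[OF nn])
  also have "\<dots> \<le> A $ i $ j * (pw A (?g - Suc u) j (x 0) * pw A u (x 0) i)"
    using seq_weight_le_pw[OF nn, of "Suc u" ?g 1 x] seq_weight_le_pw[OF nn, of 0 u 1 x] u(1) nn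
    by (intro mult_left_mono mult_mono seq_weight_nonneg pw_nonneg)
      (auto simp: ij xg nonneg_matrix_def)
  also have "\<dots> \<le> A $ i $ j * pw A (?g - 1) j i"
    using u(1) nn by (intro mult_left_mono pw_add_ge') (auto simp: nonneg_matrix_def)
  finally show ?thesis using z(1) by (intro exI[of _ "?g - 1"]) simp
qed

lemma reachable_pw_pos:
  assumes nn: "nonneg_matrix A" and "i \<rightarrow>\<^sup>*\<^bsub>mat_digraph A\<^esub> j"
  shows "\<exists>t. 0 < pw A t i j"
proof -
  have "(i, j) \<in> (arcs_ends (mat_digraph A))\<^sup>*" using assms(2) by (rule reachable_rtranclI)
  then show ?thesis
  proof (induction rule: rtrancl_induct)
    case base
    show ?case by (rule exI[of _ 0]) (simp add: pw_0)
  next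
    case (step j l)
    then obtain t where t: "0 < pw A t i j" by blast
    have "0 < A $ j $ l" using step(2) by (auto simp: arcs_ends_def arc_to_ends_def)
    then have "0 < pw A t i j * pw A 1 j l" using t by (simp add: pw_1[OF nn])
    also have "\<dots> \<le> pw A (t + 1) i l" by (rule pw_add_ge[OF nn])
    finally show ?case by blast
  qed
qed

text \<open>A node is labelled by the length of some walk to it from a fixed node \<open>k\<close>.
  Two walks to \<open>j\<close>, closed by the same return walk, both get a length divisible by the
  cyclicity, so the labels are consistent.\<close>

lemma cyclic_classes_obtain:
  fixes A :: "real^'n^'n"
  assumes nn: "nonneg_matrix A" and irr: "mat_irreducible A"
  obtains cls :: "'n \<Rightarrow> int" where
    "\<And>i j. 0 < A $ i $ j \<Longrightarrow> [cls j = cls i + 1] (mod int (cyclicity (mat_digraph A)))"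
proof -
  let ?d = "cyclicity (mat_digraph A)"
  obtain k :: 'n where True by simp
  have conn: "\<exists>t. 0 < pw A t i j" for i j
    using irr by (intro reachable_pw_pos[OF nn]) (simp add: mat_irreducible_def strongly_connected_def)
  define f where "f i = (SOME t. 0 < pw A t k i)" for i
  have f: "0 < pw A (f i) k i" for i unfolding f_def using conn by (rule someI_ex)
  have "[int (f j) = int (f i) + 1] (mod int ?d)" if ij: "0 < A $ i $ j" for i j
  proof -
    obtain s where s: "0 < pw A s j k" using conn by blast
    have "0 < pw A (f i) k i * pw A 1 i j" using f[of i] ij by (simp add: pw_1[OF nn])
    also have "\<dots> \<le> pw A (f i + 1) k j" by (rule pw_add_ge[OF nn])
    finally have "0 < pw A (f i + 1) k j * pw A s j k" using s by simp
    also have "\<dots> \<le> pw A (f i + 1 + s) k k" by (rule pw_add_ge[OF nn])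
    finally have 1: "?d dvd f i + 1 + s" by (rule closed_walk_bounds(2)[OF nn])
    have "0 < pw A (f j) k j * pw A s j k" using f[of j] s by simp
    also have "\<dots> \<le> pw A (f j + s) k k" by (rule pw_add_ge[OF nn])
    finally have 2: "?d dvd f j + s" by (rule closed_walk_bounds(2)[OF nn])
    have "int ?d dvd int (f j + s) - int (f i + 1 + s)" using 1 2 by (intro dvd_diff) (simp_all only: of_nat_dvd_iff)
    then show ?thesis by (simp add: cong_iff_dvd_diff algebra_simps)
  qed
  then show ?thesis using that[of "\<lambda>i. int (f i)"] by simp
qed

lemma cyclicity_pos:
  assumes "pre_digraph.cycle G p"
  shows "0 < cyclicity G"
proof -
  have "cyclicity G dvd length p" unfolding cyclicity_def using assms by (intro Gcd_dvd) blast
  moreover have "p \<noteq> []" using assms by (auto simp: pre_digraph.cycle_def)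
  ultimately show ?thesis by (cases "cyclicity G") auto
qed

text \<open>Makes the girth of \<open>H\<close> meaningful: a critical cycle through
  \<open>k\<close> has mutually reachable nodes and so lies within \<open>H\<close>.\<close>

lemma critical_component_cycle:
  fixes A :: "real^'n^'n"
  assumes H: "H \<in> pre_digraph.sccs (critical_digraph A)" and k: "k \<in> verts H"
  shows "\<exists>p. pre_digraph.cycle H p"
proof -
  let ?C = "critical_digraph A"
  interpret C: wf_digraph ?C by (rule wf_critical_digraph)
  have ind: "induced_subgraph H ?C" using H by (rule C.in_sccsE)
  then have H': "verts H \<subseteq> verts ?C" "arcs H = {e \<in> arcs ?C. fst e \<in> verts H \<and> snd e \<in> verts H}"
    "tail H = fst" "head H = snd" "wf_digraph H"
    by (auto simp: induced_subgraph_def subgraph_def compatible_def)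
  have "k \<in> verts ?C" using k H'(1) by blast
  then have "\<exists>p. critical_cycle A p \<and> (\<exists>e\<in>set p. k = fst e \<or> k = snd e)"
    by (simp add: critical_digraph_def)
  then obtain p where p: "critical_cycle A p" "\<exists>e\<in>set p. k = fst e \<or> k = snd e" by blast
  have "pre_digraph.cycle (mat_digraph A) p" using p(1) by (simp add: critical_cycle_def)
  then obtain z :: "int \<Rightarrow> 'n" where z: "0 < length p"
    "\<And>u v. z u = z v \<longleftrightarrow> [u = v] (mod int (length p))"
    "\<And>i. i < length p \<Longrightarrow> p ! i = (z (int i), z (int i + 1))"
    "\<And>u. (z u, z (u + 1)) \<in> set p"
    by (rule cycle_seq_obtain) (auto simp: mat_digraph_def)
  have arc: "(z u, z (u + 1)) \<in> arcs ?C" for u using z(4) p(1) by (auto simp: critical_digraph_def)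
  obtain w where w: "k = z w" using p(2) z(3) by (auto simp: in_set_conv_nth)
  have adj: "z u \<rightarrow>\<^bsub>?C\<^esub> z (u + 1)" for u
    using arc[of u] by (force simp: arcs_ends_def arc_to_ends_def)
  have reach_nat: "z u \<rightarrow>\<^sup>*\<^bsub>?C\<^esub> z (u + int t)" for u t
  proof (induction t)
    case 0
    have "z u \<in> verts ?C" using C.tail_in_verts[OF arc[of u]] by simp
    then show ?case by simp
  next
    case (Suc t)
    from C.reachable_adj_trans[OF this adj] show ?case by (simp add: ac_simps)
  qed
  have reach: "z u \<rightarrow>\<^sup>*\<^bsub>?C\<^esub> z v" for u v
  proof -
    have "0 \<le> (v - u) mod int (length p)" using z(1) by simp
    then have "z (u + int (nat ((v - u) mod int (length p)))) = z v" by (simp add: z(2) cong_def mod_simps)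
    then show ?thesis using reach_nat by metis
  qed
  have "verts H \<in> C.sccs_verts" using H by (intro C.in_sccs_vertsI_sccs) simp
  then have zH: "z u \<in> verts H" for u
    using reach[of w u] reach[of u w] k w unfolding C.in_sccs_verts_conv_reachable by blast
  let ?p = "map (\<lambda>u. (z (int u), z (int (Suc u)))) [0..<length p]"
  have "pre_digraph.cycle H ?p"
  proof (rule seq_cycle[where x = "\<lambda>u. z (int u)"])
    show "inj_on (\<lambda>u. z (int u)) {..<length p}"
      by (rule inj_onI) (auto simp: z(2) cong_def)
    show "(z (int u), z (int (Suc u))) \<in> arcs H" for u
      using arc[of "int u"] zH by (simp add: H' add.commute)
  qed (use z H' in \<open>auto simp: cong_def\<close>)
  then show ?thesis by blast
qed

section \<open>From stable rows to transients\<close>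

lemma row_transient_le:
  assumes "0 < l" "l = max_cycle_mean A" "row_stable ((1 / l) *\<^sub>R A) k p t" "0 < p"
  shows "row_periodic_from A k t" "row_transient A k \<le> t"
proof -
  have "pw A (s + p) k i = l ^ p * pw A s k i" if "t \<le> s" for s i
  proof -
    have "(1 / l) ^ (s + p) * pw A (s + p) k i = (1 / l) ^ s * pw A s k i"
      using assms(1,3) that by (simp add: row_stable_def pw_scale)
    then show ?thesis using assms(1) by (simp add: power_add power_divide field_simps)
  qed
  then show "row_periodic_from A k t" using assms(2,4) by (auto simp: row_periodic_from_def)
  then show "row_transient A k \<le> t" unfolding row_transient_def by (rule Least_le)
qed

lemma column_transient_le:
  assumes "0 < l" "l = max_cycle_mean A" "nonneg_matrix A" "0 < p"
    and "row_stable (transpose ((1 / l) *\<^sub>R A)) k p t"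
  shows "column_periodic_from A k t" "column_transient A k \<le> t"
proof -
  have nn: "nonneg_matrix ((1 / l) *\<^sub>R A)" using assms(1,3) by (simp add: nonneg_matrix_def)
  have "pw A (s + p) i k = l ^ p * pw A s i k" if "t \<le> s" for s i
  proof -
    have "(1 / l) ^ (s + p) * pw A (s + p) i k = (1 / l) ^ s * pw A s i k"
      using assms(1,5) that by (simp add: row_stable_def pw_transpose[OF nn] pw_scale)
    then show ?thesis using assms(1) by (simp add: power_add power_divide field_simps)
  qed
  then show "column_periodic_from A k t" using assms(2,4) by (auto simp: column_periodic_from_def)
  then show "column_transient A k \<le> t" unfolding column_transient_def by (rule Least_le)
qed

text \<open>Formulated for an arbitrary labelling: a single class yields the bounds for all
  matrices, the cyclic classes of an irreducible matrix the other two.\<close>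

lemma transients_bounds:
  fixes A :: "real^'n^'n"
  assumes nn: "nonneg_matrix A"
    and H: "H \<in> pre_digraph.sccs (critical_digraph A)" and k: "k \<in> verts H"
    and d: "0 < d" and cls: "\<And>i j. 0 < A $ i $ j \<Longrightarrow> [cls j = cls i + 1] (mod int d)"
  shows "\<exists>t. row_periodic_from A k t" "\<exists>t. column_periodic_from A k t"
    "transients_le A k (int (d * Wi (CARD('n) div d) + CARD('n) mod d))"
    "transients_le A k ((int (CARD('n) div d) - 2) * int (girth H)
      + min (int CARD('n)) (int (card (verts H)) + int (CARD('n) mod d)))"
proof -
  let ?C = "critical_digraph A"
  let ?l = "max_cycle_mean A"
  define B where "B = (1 / ?l) *\<^sub>R A"
  define g where "g = girth H"
  define R where "R = arcs H"
  interpret C: wf_digraph ?C by (rule wf_critical_digraph)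
  have ind: "induced_subgraph H ?C" "strongly_connected H" using H by (simp_all add: C.sccs_def)
  then have H': "verts H \<subseteq> verts ?C" "arcs H \<subseteq> arcs ?C" "tail H = fst" "head H = snd" "wf_digraph H"
    by (auto simp: induced_subgraph_def subgraph_def compatible_def)
  have "k \<in> verts ?C" using k H'(1) by blast
  then obtain pc where "critical_cycle A pc" by (auto simp: critical_digraph_def)
  then have l: "0 < ?l" by (rule critical_cycle_weight(2))
  have nnB: "nonneg_matrix B" using nn l by (simp add: B_def nonneg_matrix_def)
  have pwB: "pw B t i j = (1 / ?l) ^ t * pw A t i j" for t i j using l by (simp add: B_def pw_scale)
  have B: "normalized B"
    unfolding normalized_def
  proof (intro conjI allI nnB)
    fix t i
    show "pw B t i i \<le> 1"
    proof (cases "0 < pw A t i i")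
      case True
      from closed_walk_bounds(1)[OF nn this] show ?thesis using l by (simp add: pwB field_simps power_divide)
    next
      case False
      then have "pw A t i i = 0" using pw_nonneg[OF nn, of t i i] by simp
      then show ?thesis by (simp add: pwB)
    qed
  qed
  have R_crit: "R \<subseteq> crit B"
  proof
    fix e assume "e \<in> R"
    then obtain p i j where p: "critical_cycle A p" "(i, j) \<in> set p" "e = (i, j)"
      using H'(2) by (cases e) (auto simp: R_def critical_digraph_def)
    obtain t where "?l ^ Suc t \<le> A $ i $ j * pw A t j i"
      using critical_arc_return[OF nn p(1,2)] by blast
    then have "1 \<le> B $ i $ j * pw B t j i"
      using l by (simp add: pwB) (simp add: B_def field_simps power_divide)
    then show "e \<in> crit B" using p(3) by (auto simp: crit_def)
  qed
  have RV: "R \<subseteq> verts H \<times> verts H"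
    using wf_digraph.tail_in_verts[OF H'(5)] wf_digraph.head_in_verts[OF H'(5)] by (auto simp: R_def H')
  have "\<exists>n p. pre_digraph.cycle H p \<and> length p = n" using critical_component_cycle[OF H k] by blast
  then have "\<exists>p. pre_digraph.cycle H p \<and> length p = g" unfolding g_def girth_def by (rule LeastI_ex)
  then obtain p where p: "pre_digraph.cycle H p" "length p = g" by blast
  obtain z :: "int \<Rightarrow> 'n" where z': "0 < length p" "set p \<subseteq> arcs H"
    "\<And>u v. z u = z v \<longleftrightarrow> [u = v] (mod int (length p))"
    "\<And>i. i < length p \<Longrightarrow> p ! i = (z (int i), z (int i + 1))"
    "\<And>u. (z u, z (u + 1)) \<in> set p"
    by (rule cycle_seq_obtain[OF p(1) H'(3,4)]) (rule that)
  note z = z'(1-3)[unfolded p(2)] z'(5)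
  have zR: "(z u, z (u + 1)) \<in> R" for u using z(2,4) by (auto simp: R_def)
  have endsR: "arcs_ends H = R" by (auto simp: arcs_ends_def arc_to_ends_def R_def H')
  have zV: "z 0 \<in> verts H" using zR[of 0] RV by auto
  have reach: "(k, z 0) \<in> R\<^sup>*" "(z 0, k) \<in> R\<^sup>*"
    using ind(2) k zV reachable_rtranclI unfolding strongly_connected_def endsR[symmetric] by metis+
  have clsB: "\<forall>i j. 0 < B $ i $ j \<longrightarrow> [cls j = cls i + 1] (mod int d)"
    using cls l by (simp add: B_def zero_less_divide_iff)
  note row = critical_row_bounds[OF B R_crit RV refl z(1,3) zR reach(1) d clsB]
  \<comment> \<open>For columns the matrix is transposed, which reverses the arcs and the cycle and
    negates the labels.\<close>
  have T: "R\<inverse> \<subseteq> crit (transpose B)" "R\<inverse> \<subseteq> verts H \<times> verts H"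
    using R_crit crit_transpose[OF B] RV by auto
  have zT: "z (- u) = z (- v) \<longleftrightarrow> [u = v] (mod int g)" "(z (- u), z (- (u + 1))) \<in> R\<inverse>" for u v
    using zR[of "- u - 1"] by (simp_all add: z(3) cong_minus_minus_iff)
  have reachT: "(k, z (- 0)) \<in> (R\<inverse>)\<^sup>*" using reach(2) by (simp add: rtrancl_converse)
  have clsT: "\<forall>i j. 0 < transpose B $ i $ j \<longrightarrow> [- cls j = - cls i + 1] (mod int d)"
  proof (intro allI impI)
    fix i j assume "0 < transpose B $ i $ j"
    then have "int d dvd cls i - (cls j + 1)" using clsB by (simp add: transpose_def cong_iff_dvd_diff)
    then show "[- cls j = - cls i + 1] (mod int d)" by (simp add: cong_iff_dvd_diff algebra_simps)
  qed
  note column = critical_row_bounds[where z = "\<lambda>u. z (- u)" and cls = "\<lambda>i. - cls i",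
      OF normalized_transpose[OF B] T refl z(1) zT reachT d clsT]
  note transient = row_transient_le[OF l refl, folded B_def] column_transient_le[OF l refl nn, folded B_def]
  show "\<exists>t. row_periodic_from A k t" "\<exists>t. column_periodic_from A k t"
    using transient(1)[OF row(1) z(1)] transient(3)[OF z(1) column(1)] by blast+
  show "transients_le A k (int (d * Wi (CARD('n) div d) + CARD('n) mod d))"
    using transient(2)[OF row(1) z(1)] transient(4)[OF z(1) column(1)]
    by (simp add: transients_le_def del: of_nat_add of_nat_mult)
  show "transients_le A k ((int (CARD('n) div d) - 2) * int (girth H)
      + min (int CARD('n)) (int (card (verts H)) + int (CARD('n) mod d)))"
    using row(2) column(2) transient(2)[OF _ z(1)] transient(4)[OF z(1)]
    unfolding transients_le_def g_def[symmetric] by (meson of_nat_le_iff order_trans)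
qed

theorem theorem1:
  fixes A :: "real^'n^'n" and k :: 'n and H :: "('n, 'n \<times> 'n) pre_digraph"
  assumes "\<forall>i j. A $ i $ j \<ge> 0"
    and "k \<in> verts (critical_digraph A)"
    and "H \<in> pre_digraph.sccs (critical_digraph A)"
    and "k \<in> verts H"
  shows "(\<exists>t. row_periodic_from A k t) \<and> (\<exists>t. column_periodic_from A k t) \<and>
    transients_le A k (int (Wi CARD('n))) \<and>
    transients_le A k ((int CARD('n) - 2) * int (girth H) + int (card (verts H))) \<and>
    (mat_irreducible A \<longrightarrow>
      (let n = CARD('n); d = cyclicity (mat_digraph A) in
        transients_le A k (int (d * Wi (n div d) + n mod d)) \<and>
        transients_le A k
          ((int (n div d) - 2) * int (girth H)
            + min (int n) (int (card (verts H)) + int (n mod d)))))"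
proof -
  have nn: "nonneg_matrix A" using assms(1) by (simp add: nonneg_matrix_def)
  note bounds = transients_bounds[OF nn assms(3,4)]
  \<comment> \<open>With a single class the quotient is \<open>CARD('n)\<close> and the remainder 0,
    which turns the general bounds into those of Wielandt and Dulmage-Mendelsohn.\<close>
  note one_class = bounds[where cls = "\<lambda>_. 0" and d = 1, simplified]
  have "card (verts H) \<le> CARD('n)" by (rule card_mono) auto
  then have "transients_le A k (int (Wi CARD('n)))"
    "transients_le A k ((int CARD('n) - 2) * int (girth H) + int (card (verts H)))"
    using one_class(3,4) by (simp_all add: min_absorb2)
  moreover have "transients_le A k (int (d * Wi (CARD('n) div d) + CARD('n) mod d)) \<and>
      transients_le A k ((int (CARD('n) div d) - 2) * int (girth H)
        + min (int CARD('n)) (int (card (verts H)) + int (CARD('n) mod d)))"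
    if irr: "mat_irreducible A" and d: "d = cyclicity (mat_digraph A)" for d
  proof -
    obtain p where "critical_cycle A p" using assms(2) by (auto simp: critical_digraph_def)
    then have "0 < d" using cyclicity_pos[of "mat_digraph A" p] by (simp add: d critical_cycle_def)
    moreover obtain cls where "\<And>i j. 0 < A $ i $ j \<Longrightarrow> [cls j = cls i + 1] (mod int d)"
      using cyclic_classes_obtain[OF nn irr] unfolding d by blast
    ultimately show ?thesis using bounds(3,4)[of d cls] by blast
  qed
  ultimately show ?thesis using one_class(1,2) unfolding Let_def by blast
qed

end
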